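(* Let $f(z)\in\mathbb{Z}[[z]]$ be a power series analytic in the open unit disk such that $$A(z)+B(z)f(z)+C(z)f(z^2)=0,$$ where $A(z),B(z),C(z)\in\mathbb{Z}[z]$ satisfy one of the following conditions: (i) $B(0)\equiv1$ and $C(0)\equiv0 \pmod 2$; (ii) $A(0)\equiv0$, $B(0)\equiv1$ and $C(0)\not\equiv0\pmod 2$. Let $b\ge2$ be an integer such that $B(1/b^{2^m})C(1/b^{2^m})\neq0$ for all integers $m\ge0$. If the reduction of $f(z)$ modulo $2$ is not a rational function, then $f(1/b)$ is transcendental and its irrationality exponent is equal to $2$.
   Context: The reduction of $f$ modulo $2$ is the series in $\mathbb{F}_2[[z]]$ obtained by reducing each coefficient modulo 2; it is a rational function if it equals $P/Q$ for some $P,Q\in\mathbb{F}_2[z]$ with $Q\neq0$. The irrationality exponent $\mu(\xi)$ of an irrational real number $\xi$ is the supremum of the real numbers $\mu$ such that $|\xi-p/q|<q^{-\mu}$ has infinitely many solutions in rational numbers $p/q$. *)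

theory Defs
  imports "HOL-Analysis.Analysis" "HOL-Library.Z2"
    "HOL-Computational_Algebra.Polynomial" "HOL-Computational_Algebra.Formal_Power_Series"
    "HOL-Computational_Algebra.Polynomial_FPS"
begin

definition fps_mod2 :: "(nat \<Rightarrow> int) \<Rightarrow> bit fps" where
  "fps_mod2 f = Abs_fps (\<lambda>n. if even (f n) then 0 else 1)"

definition rational_fps_F2 :: "bit fps \<Rightarrow> bool" where
  "rational_fps_F2 g \<longleftrightarrow> (\<exists>P Q :: bit poly. Q \<noteq> 0 \<and> fps_of_poly Q * g = fps_of_poly P)"

definition irrationality_exponent :: "real \<Rightarrow> ereal" where
  "irrationality_exponent xi = Sup (ereal ` {mu :: real.
     infinite {r :: rat. case quotient_of r of (p, q) \<Rightarrow>
        \<bar>xi - real_of_int p / real_of_int q\<bar> < (real_of_int q) powr (- mu)}})"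

end

theory Submission
  imports Defs
begin

text \<open>
  Modulo 2 the equation reads \<open>A + B F + C F\<^sup>2 = 0\<close>, because \<open>F(z\<^sup>2) = F(z)\<^sup>2\<close> over the field with two
  elements. So \<open>F\<close> is an irrational quadratic series, and Liouville's argument shows that
  \<open>p + q F\<close> with \<open>deg p, deg q \<le> N\<close> vanishes at 0 to order at most \<open>2 N + O(1)\<close>. Linear algebra gives
  integer polynomials \<open>p, q\<close>, not both even, for which the order over the integers is at least
  \<open>2 N + 1\<close>; hence it is \<open>2 N + O(1)\<close> exactly, with no Hankel determinants involved. Evaluating
  at \<open>1 / b\<^bsup>2^m\<^esup>\<close> and iterating the functional equation turns these forms into integer linear forms in
  \<open>1, \<xi> = f(1/b)\<close> of size \<open>X\<^bsup>-N + O(1)\<^esup>\<close>, from above and from below, with coefficients at most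
  \<open>X\<^bsup>N + O(1)\<^esup>\<close>, where \<open>X = b\<^bsup>2^m\<^esup>\<close>. Letting \<open>N\<close> range over an interval from \<open>K\<close> to \<open>2 K\<close> with \<open>K\<close> large
  makes the sequence dense enough to force irrationality exponent 2.

  Transcendence is Mahler's method: if \<open>\<xi>\<close> were algebraic, a form \<open>\<Sum>\<^sub>j P\<^sub>j F\<^sup>j\<close> vanishing to high order
  at 0, evaluated at \<open>1 / b\<^bsup>2^m\<^esup>\<close>, would be a polynomial in \<open>\<xi>\<close> too small for Liouville's inequality.
  The form does not vanish identically: otherwise its leading coefficient times \<open>F\<close> is bounded
  on the unit disk, and since it has integer coefficients Parseval's identity makes it a
  polynomial, so \<open>F\<close> would be rational, also modulo 2.
\<close>

unbundle no vec_syntax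
unbundle fps_syntax

section \<open>Homogeneous integer linear systems\<close>

text \<open>A crude form of Siegel's lemma, by fraction-free elimination. What matters is that
  \<open>C\<close> and \<open>E\<close> depend on \<open>k\<close> alone, so the bound is polynomial
  in the size of the entries with a fixed exponent.\<close>

lemma integer_system_solution:
  fixes k :: nat
  shows "\<exists>C E. \<forall>(J :: 'a set) (a :: nat \<Rightarrow> 'a \<Rightarrow> int) (H :: int).
    finite J \<and> card J = Suc k \<and> H \<ge> 1 \<and> (\<forall>i<k. \<forall>j\<in>J. \<bar>a i j\<bar> \<le> H) \<longrightarrow>
    (\<exists>x. (\<exists>j\<in>J. x j \<noteq> 0) \<and> (\<forall>i<k. (\<Sum>j\<in>J. a i j * x j) = 0) \<and> (\<forall>j\<in>J. \<bar>x j\<bar> \<le> C * H ^ E))"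
proof (induction k)
  case 0
  show ?case
    by (rule exI[of _ 1], rule exI[of _ 0]) (auto simp: card_Suc_eq intro!: exI[of _ "\<lambda>_. 1"])
next
  case (Suc k)
  then obtain C E where "\<forall>(J :: 'a set) (a :: nat \<Rightarrow> 'a \<Rightarrow> int) (H :: int).
    finite J \<and> card J = Suc k \<and> H \<ge> 1 \<and> (\<forall>i<k. \<forall>j\<in>J. \<bar>a i j\<bar> \<le> H) \<longrightarrow>
    (\<exists>x. (\<exists>j\<in>J. x j \<noteq> 0) \<and> (\<forall>i<k. (\<Sum>j\<in>J. a i j * x j) = 0) \<and> (\<forall>j\<in>J. \<bar>x j\<bar> \<le> C * H ^ E))"
    by (elim exE)
  note IH = this[rule_format, OF conjI, OF _ conjI, OF _ _ conjI]
  \<comment> \<open>After elimination the entries are at most \<open>2 * H^2\<close>, hence the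
    values at most \<open>|C| * 2^E * H^(2 * E)\<close>; recovering the pivot unknown sums
    \<open>k + 1\<close> products with entries of size \<open>H\<close>.\<close>
  define C' where "C' = int (Suc k) * (\<bar>C\<bar> * 2 ^ E)"
  define E' where "E' = 2 * E + 1"
  have main: "\<exists>x. (\<exists>j\<in>J. x j \<noteq> 0) \<and> (\<forall>i<Suc k. (\<Sum>j\<in>J. a i j * x j) = 0) \<and> (\<forall>j\<in>J. \<bar>x j\<bar> \<le> C' * H ^ E')"
    if J: "finite J" "card J = Suc (Suc k)" and H: "H \<ge> 1" and a: "\<forall>i<Suc k. \<forall>j\<in>J. \<bar>a i j\<bar> \<le> H"
    for J :: "'a set" and a :: "nat \<Rightarrow> 'a \<Rightarrow> int" and H :: int
  proof (cases "\<forall>j\<in>J. a k j = 0")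
    case True
    \<comment> \<open>The last equation is void, so an arbitrary unknown can be set to 0.\<close>
    from J obtain j0 where j0: "j0 \<in> J" by fastforce
    have "finite (J - {j0})" "card (J - {j0}) = Suc k"
      using J j0 by auto
    moreover have "\<forall>i<k. \<forall>j\<in>J - {j0}. \<bar>a i j\<bar> \<le> H" using a by auto
    ultimately have "\<exists>x. (\<exists>j\<in>J - {j0}. x j \<noteq> 0) \<and> (\<forall>i<k. (\<Sum>j\<in>J - {j0}. a i j * x j) = 0) \<and>
        (\<forall>j\<in>J - {j0}. \<bar>x j\<bar> \<le> C * H ^ E)"
      using H by (intro IH)
    then obtain x where x: "\<exists>j\<in>J - {j0}. x j \<noteq> 0"
        "\<forall>i<k. (\<Sum>j\<in>J - {j0}. a i j * x j) = 0" "\<forall>j\<in>J - {j0}. \<bar>x j\<bar> \<le> C * H ^ E"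
      by (elim exE conjE)
    define y where "y = (\<lambda>j. if j = j0 then 0 else x j)"
    have sum_y: "(\<Sum>j\<in>J. a i j * y j) = (\<Sum>j\<in>J - {j0}. a i j * x j)" for i
      by (subst sum.remove[OF J(1) j0]) (auto simp: y_def intro!: sum.cong)
    have "C * H ^ E \<le> C' * H ^ E'"
    proof -
      have "C \<le> \<bar>C\<bar> * 1" by simp
      also have "\<dots> \<le> \<bar>C\<bar> * 2 ^ E" by (intro mult_left_mono) auto
      also have "\<dots> \<le> int (Suc k) * (\<bar>C\<bar> * 2 ^ E)"
        using mult_right_mono[of 1 "int (Suc k)" "\<bar>C\<bar> * 2 ^ E"] by simp
      finally have "C \<le> C'" by (simp add: C'_def)
      moreover have "H ^ E \<le> H ^ E'" using H by (intro power_increasing) (auto simp: E'_def)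
      moreover have "C' \<ge> 0" by (simp add: C'_def)
      ultimately show ?thesis using H by (intro mult_mono) auto
    qed
    moreover have "C' * H ^ E' \<ge> 0" using H by (auto simp: C'_def)
    ultimately have "\<forall>j\<in>J. \<bar>y j\<bar> \<le> C' * H ^ E'"
      using x(3) by (auto simp: y_def intro: order_trans)
    moreover have "\<exists>j\<in>J. y j \<noteq> 0" using x(1) by (auto simp: y_def)
    moreover have "\<forall>i<Suc k. (\<Sum>j\<in>J. a i j * y j) = 0"
      using x(2) True by (auto simp: less_Suc_eq sum_y)
    ultimately show ?thesis by blast
  next
    case False
    then obtain j0 where j0: "j0 \<in> J" "a k j0 \<noteq> 0" by blast
    \<comment> \<open>Cross multiplication with the pivot \<open>a k j0\<close> removes the unknown
      \<open>j0\<close> without leaving the integers.\<close>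
    define a' where "a' i j = a k j0 * a i j - a i j0 * a k j" for i j
    have "finite (J - {j0})" "card (J - {j0}) = Suc k"
      using J j0 by auto
    moreover have "\<bar>a' i j\<bar> \<le> 2 * H\<^sup>2" if "i < k" "j \<in> J - {j0}" for i j
    proof -
      have "\<bar>a' i j\<bar> \<le> \<bar>a k j0\<bar> * \<bar>a i j\<bar> + \<bar>a i j0\<bar> * \<bar>a k j\<bar>"
        unfolding a'_def by (metis abs_mult abs_triangle_ineq4)
      also have "\<dots> \<le> H * H + H * H"
        using a H that j0 by (intro add_mono mult_mono) auto
      finally show ?thesis by (simp add: power2_eq_square)
    qed
    moreover have "2 * H\<^sup>2 \<ge> 1" using one_le_power[OF H, of 2] by linarith
    ultimately have "\<exists>x. (\<exists>j\<in>J - {j0}. x j \<noteq> 0) \<and> (\<forall>i<k. (\<Sum>j\<in>J - {j0}. a' i j * x j) = 0) \<and>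
        (\<forall>j\<in>J - {j0}. \<bar>x j\<bar> \<le> C * (2 * H\<^sup>2) ^ E)"
      by (intro IH) auto
    then obtain x where x: "\<exists>j\<in>J - {j0}. x j \<noteq> 0"
        "\<forall>i<k. (\<Sum>j\<in>J - {j0}. a' i j * x j) = 0" "\<forall>j\<in>J - {j0}. \<bar>x j\<bar> \<le> C * (2 * H\<^sup>2) ^ E"
      by (elim exE conjE)
    \<comment> \<open>Scaling the other unknowns by the pivot makes the value that equation
      \<open>k\<close> forces on \<open>j0\<close> an integer.\<close>
    define y where "y = (\<lambda>j. if j = j0 then - (\<Sum>j\<in>J - {j0}. a k j * x j) else a k j0 * x j)"
    have sum_y: "(\<Sum>j\<in>J. a i j * y j) = (\<Sum>j\<in>J - {j0}. a' i j * x j)" for i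
      by (subst sum.remove[OF J(1) j0(1)])
         (auto simp: y_def a'_def sum_distrib_left sum_subtractf algebra_simps intro!: sum.cong)
    have a'_k: "a' k j = 0" for j by (simp add: a'_def)
    have "\<forall>i<Suc k. (\<Sum>j\<in>J. a i j * y j) = 0"
      using x(2) a'_k by (auto simp: less_Suc_eq sum_y)
    moreover have "\<exists>j\<in>J. y j \<noteq> 0" using x(1) j0 by (auto simp: y_def)
    moreover have "\<bar>y j\<bar> \<le> C' * H ^ E'" if "j \<in> J" for j
    proof -
      define M where "M = \<bar>C\<bar> * 2 ^ E * H ^ (2 * E)"
      have M: "M \<ge> 0" using H by (simp add: M_def)
      have xM: "\<bar>x j\<bar> \<le> M" if "j \<in> J - {j0}" for j
      proof -
        have "\<bar>x j\<bar> \<le> C * (2 * H\<^sup>2) ^ E" using x(3) that by blast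
        also have "\<dots> \<le> \<bar>C\<bar> * (2 * H\<^sup>2) ^ E" by (intro mult_right_mono) auto
        finally show ?thesis by (simp add: M_def power_mult_distrib power_mult)
      qed
      have C'M: "C' * H ^ E' = int (Suc k) * (H * M)"
        by (simp add: C'_def M_def E'_def)
      show ?thesis
      proof (cases "j = j0")
        case True
        have "\<bar>y j\<bar> \<le> (\<Sum>j\<in>J - {j0}. \<bar>a k j * x j\<bar>)"
          using True by (simp add: y_def sum_abs)
        also have "\<dots> \<le> (\<Sum>j\<in>J - {j0}. H * M)"
          unfolding abs_mult using xM a H M by (intro sum_mono mult_mono) auto
        also have "\<dots> = int (Suc k) * (H * M)" using J j0 by simp
        finally show ?thesis using C'M by simp
      next
        case False
        then have "\<bar>y j\<bar> = \<bar>a k j0\<bar> * \<bar>x j\<bar>" by (simp add: y_def abs_mult)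
        also have "\<dots> \<le> H * M" using xM a H that False j0 by (intro mult_mono) auto
        also have "\<dots> \<le> int (Suc k) * (H * M)"
          using mult_right_mono[of 1 "int (Suc k)" "H * M"] H M by simp
        finally show ?thesis using C'M by simp
      qed
    qed
    ultimately show ?thesis by blast
  qed
  then show ?case by blast
qed

text \<open>A nonzero solution with least sum of absolute values has an odd entry, since otherwise
  half of it would be a smaller one. This keeps the coefficients of the auxiliary form from all
  vanishing modulo 2.\<close>

lemma integer_system_odd_solution:
  fixes a :: "nat \<Rightarrow> 'a \<Rightarrow> int"
  assumes J: "finite J" "card J > k"
  obtains x where "\<exists>j\<in>J. odd (x j)" "\<And>i. i < k \<Longrightarrow> (\<Sum>j\<in>J. a i j * x j) = 0"
proof -
  from J obtain J' where J': "J' \<subseteq> J" "card J' = Suc k" "finite J'"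
    by (meson Suc_leI finite_subset obtain_subset_with_card_n)
  define H where "H = (\<Sum>i<k. \<Sum>j\<in>J'. \<bar>a i j\<bar>) + 1"
  have "\<bar>a i j\<bar> \<le> H" if "i < k" "j \<in> J'" for i j
  proof -
    have "\<bar>a i j\<bar> \<le> (\<Sum>j\<in>J'. \<bar>a i j\<bar>)" using that J' by (intro member_le_sum) auto
    also have "\<dots> \<le> (\<Sum>i<k. \<Sum>j\<in>J'. \<bar>a i j\<bar>)"
      using that by (intro member_le_sum[of i "{..<k}" "\<lambda>i. \<Sum>j\<in>J'. \<bar>a i j\<bar>"]) (auto intro: sum_nonneg)
    finally show ?thesis by (simp add: H_def)
  qed
  moreover have "H \<ge> 1" by (auto simp: H_def intro!: sum_nonneg)
  ultimately have bounds: "finite J' \<and> card J' = Suc k \<and> H \<ge> 1 \<and> (\<forall>i<k. \<forall>j\<in>J'. \<bar>a i j\<bar> \<le> H)"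
    using J' by blast
  obtain C E where "\<forall>(J :: 'a set) (a :: nat \<Rightarrow> 'a \<Rightarrow> int) (H :: int).
    finite J \<and> card J = Suc k \<and> H \<ge> 1 \<and> (\<forall>i<k. \<forall>j\<in>J. \<bar>a i j\<bar> \<le> H) \<longrightarrow>
    (\<exists>x. (\<exists>j\<in>J. x j \<noteq> 0) \<and> (\<forall>i<k. (\<Sum>j\<in>J. a i j * x j) = 0) \<and> (\<forall>j\<in>J. \<bar>x j\<bar> \<le> C * H ^ E))"
    using integer_system_solution[of k, where 'a = 'a] by (elim exE)
  from this[rule_format, OF bounds]
  obtain y where y: "\<exists>j\<in>J'. y j \<noteq> 0" "\<forall>i<k. (\<Sum>j\<in>J'. a i j * y j) = 0"
    by (elim exE conjE)
  define z where "z = (\<lambda>j. if j \<in> J' then y j else 0)"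
  have "(\<Sum>j\<in>J. a i j * z j) = (\<Sum>j\<in>J'. a i j * y j)" for i
    using J J' by (intro sum.mono_neutral_cong_right) (auto simp: z_def)
  then have z: "\<exists>j\<in>J. z j \<noteq> 0" "\<forall>i<k. (\<Sum>j\<in>J. a i j * z j) = 0"
    using y J' by (auto simp: z_def)
  define P where "P x \<longleftrightarrow> (\<exists>j\<in>J. x j \<noteq> 0) \<and> (\<forall>i<k. (\<Sum>j\<in>J. a i j * x j) = 0)" for x
  have "P z" using z by (simp add: P_def)
  then obtain x where x: "P x" "\<And>x'. P x' \<Longrightarrow> nat (\<Sum>j\<in>J. \<bar>x j\<bar>) \<le> nat (\<Sum>j\<in>J. \<bar>x' j\<bar>)"
    using ex_has_least_nat[of P z "\<lambda>x. nat (\<Sum>j\<in>J. \<bar>x j\<bar>)"] by blast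
  have "\<exists>j\<in>J. odd (x j)"
  proof (rule ccontr)
    assume "\<not> ?thesis"
    then have ev: "2 * (x j div 2) = x j" if "j \<in> J" for j using that by simp
    have "P (\<lambda>j. x j div 2)"
    proof -
      have "(\<Sum>j\<in>J. a i j * x j) = 2 * (\<Sum>j\<in>J. a i j * (x j div 2))" for i
        unfolding sum_distrib_left
        by (intro sum.cong refl) (simp add: ev flip: mult.left_commute[of _ 2])
      moreover have "x j div 2 \<noteq> 0" if "j \<in> J" "x j \<noteq> 0" for j
        using ev[OF that(1)] that(2) by auto
      ultimately show ?thesis using x(1) by (auto simp: P_def)
    qed
    from x(2)[OF this] have "nat (\<Sum>j\<in>J. \<bar>x j\<bar>) \<le> nat (\<Sum>j\<in>J. \<bar>x j div 2\<bar>)" .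
    moreover have "(\<Sum>j\<in>J. \<bar>x j\<bar>) = 2 * (\<Sum>j\<in>J. \<bar>x j div 2\<bar>)"
      unfolding sum_distrib_left
    proof (intro sum.cong refl)
      show "\<bar>x j\<bar> = 2 * \<bar>x j div 2\<bar>" if "j \<in> J" for j
        using ev[OF that] by linarith
    qed
    moreover from x(1) obtain j where j: "j \<in> J" "x j \<noteq> 0" by (auto simp: P_def)
    have "0 < (\<Sum>j\<in>J. \<bar>x j\<bar>)"
      using j J member_le_sum[of j J "\<lambda>j. \<bar>x j\<bar>"] by fastforce
    ultimately show False by linarith
  qed
  then show thesis using that x(1) by (auto simp: P_def)
qed

section \<open>Liouville's inequality\<close>

abbreviation (input) of_int_poly :: "int poly \<Rightarrow> 'a::comm_ring_1 poly" where
  "of_int_poly \<equiv> map_poly of_int"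

lemma of_int_poly_add: "of_int_poly (p + q) = of_int_poly p + of_int_poly q"
  by (intro poly_eqI) (simp add: coeff_map_poly)

lemma of_int_poly_diff: "of_int_poly (p - q) = of_int_poly p - of_int_poly q"
  by (intro poly_eqI) (simp add: coeff_map_poly)

lemma of_int_poly_smult: "of_int_poly (smult c p) = smult (of_int c) (of_int_poly p)"
  by (intro poly_eqI) (simp add: coeff_map_poly)

lemma of_int_poly_mult: "of_int_poly (p * q) = of_int_poly p * of_int_poly q"
  by (intro poly_eqI) (simp add: coeff_map_poly coeff_mult)

lemma of_int_poly_1: "of_int_poly 1 = 1"
  by (intro poly_eqI) (simp add: coeff_map_poly)

lemma of_int_poly_power: "of_int_poly (p ^ n) = of_int_poly p ^ n"
  by (induction n) (simp_all add: of_int_poly_mult of_int_poly_1)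

lemma of_int_poly_pCons: "of_int_poly (pCons c p) = pCons (of_int c) (of_int_poly p)"
  by (intro poly_eqI) (simp add: coeff_map_poly coeff_pCons split: nat.split)

lemma of_int_poly_sum: "of_int_poly (sum f I) = (\<Sum>i\<in>I. of_int_poly (f i))"
  by (intro poly_eqI) (simp add: coeff_map_poly coeff_sum)

lemmas of_int_poly_simps =
  of_int_poly_add of_int_poly_diff of_int_poly_smult of_int_poly_mult of_int_poly_1
  of_int_poly_power of_int_poly_pCons of_int_poly_sum

lemma poly_eq_sum_coeff:
  assumes "degree p \<le> n"
  shows "poly p (x :: 'a :: comm_semiring_1) = (\<Sum>i\<le>n. coeff p i * x ^ i)"
proof -
  have "(\<Sum>i\<le>n. coeff p i * x ^ i) = (\<Sum>i\<le>degree p. coeff p i * x ^ i)"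
    using assms by (intro sum.mono_neutral_right) (auto simp: coeff_eq_0)
  then show ?thesis by (simp add: poly_altdef)
qed

lemma poly_of_int_poly_eq_sum:
  assumes "degree p \<le> n"
  shows "poly (of_int_poly p) (x :: 'a :: comm_ring_1) = (\<Sum>i\<le>n. of_int (coeff p i) * x ^ i)"
  by (subst poly_eq_sum_coeff[of _ n]) (use assms in \<open>auto simp: coeff_map_poly coeff_eq_0 intro!: degree_le\<close>)

lemma algebraic_int_poly:
  assumes "algebraic (x :: 'a :: field_char_0)"
  obtains p :: "int poly" where "p \<noteq> 0" "poly (of_int_poly p) x = 0"
proof -
  from assms obtain q where q: "\<And>i. coeff q i \<in> \<int>" "q \<noteq> 0" "poly q x = 0"
    by (elim algebraicE) auto
  obtain g :: "'a \<Rightarrow> int" where g: "\<And>y. y \<in> \<int> \<Longrightarrow> of_int (g y) = y"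
    by (metis Ints_cases)
  have g0: "g 0 = 0" using g[of 0] by simp
  have "of_int_poly (map_poly g q) = q"
    using q(1) by (intro poly_eqI) (simp add: coeff_map_poly g0 g)
  moreover from this have "map_poly g q \<noteq> 0" using q(2) by force
  ultimately show thesis using that[of "map_poly g q"] q(3) by simp
qed

text \<open>
  No conjugates or resultants are used: an integer system of fixed size yields a polynomial \<open>U\<close>
  of degree below that of \<open>x\<close> with \<open>\<tau> S(x) U(x)\<close> a nonzero integer. The exponent this gives is worse
  than the classical one, but only its independence of \<open>s\<close> matters.
\<close>

lemma algebraic_Liouville_bound:
  fixes x :: "'a :: real_normed_field"
  assumes "algebraic x"
  obtains E :: nat where "\<And>s. \<exists>c>0. \<forall>(S :: int poly) (H :: int). degree S \<le> s \<and> H \<ge> 1 \<and>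
    (\<forall>i. \<bar>coeff S i\<bar> \<le> H) \<and> poly (of_int_poly S) x \<noteq> 0 \<longrightarrow>
    c \<le> norm (poly (of_int_poly S) x) * of_int H ^ E"
proof -
  define ann :: "int poly \<Rightarrow> bool" where "ann p \<longleftrightarrow> p \<noteq> 0 \<and> poly (of_int_poly p) x = 0" for p
  obtain p0 where "ann p0" using algebraic_int_poly[OF assms] unfolding ann_def by metis
  then obtain p where p: "ann p" and p_min: "\<And>q. ann q \<Longrightarrow> degree p \<le> degree q"
    using ex_has_least_nat[of ann p0 degree] by blast
  define D where "D = degree p"
  define t where "t = lead_coeff p"
  have t: "t \<noteq> 0" using p by (simp add: t_def ann_def)
  have D: "D > 0"
  proof (rule ccontr)
    assume "\<not> D > 0"
    then obtain c where "p = [:c:]" unfolding D_def using degree_eq_zeroE by blast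
    with p show False by (simp add: ann_def of_int_poly_pCons)
  qed
  \<comment> \<open>Minimality of the degree makes \<open>1, x, ..., x^(D - 1)\<close> linearly
    independent over the integers.\<close>
  have indep: "q = 0" if "poly (of_int_poly q) x = 0" "\<And>i. i \<ge> D \<Longrightarrow> coeff q i = 0" for q
  proof (rule ccontr)
    assume "q \<noteq> 0"
    then have "D \<le> degree q" using p_min[of q] that by (simp add: ann_def D_def)
    then have "lead_coeff q = 0" using that(2) by blast
    with \<open>q \<noteq> 0\<close> show False by simp
  qed
  \<comment> \<open>Multiplication by \<open>t x\<close> may create a term of degree
    \<open>D\<close>; a multiple of \<open>p\<close> cancels it because \<open>t\<close> is the
    leading coefficient of \<open>p\<close>.\<close>
  have "\<exists>r. (\<forall>l\<ge>D. coeff r l = 0) \<and> poly (of_int_poly r) x = of_int t ^ i * x ^ i" for i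
  proof (induction i)
    case 0
    show ?case using D by (intro exI[of _ 1]) (auto simp: of_int_poly_1)
  next
    case (Suc i)
    then obtain r where r: "\<And>l. l \<ge> D \<Longrightarrow> coeff r l = 0" "poly (of_int_poly r) x = of_int t ^ i * x ^ i"
      by blast
    define q where "q = smult t (pCons 0 r) - smult (coeff r (D - 1)) p"
    have "coeff q l = 0" if "l \<ge> D" for l
    proof (cases "l = D")
      case True
      with D show ?thesis by (simp add: q_def coeff_pCons D_def t_def split: nat.split)
    next
      case False
      with that have "l > D" by simp
      then have "coeff p l = 0" by (simp add: D_def coeff_eq_0)
      moreover from \<open>l > D\<close> have "coeff (pCons 0 r) l = 0"
        using r(1)[of "l - 1"] by (cases l) auto
      ultimately show ?thesis by (simp add: q_def del: smult_pCons)
    qed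
    moreover have "poly (of_int_poly q) x = of_int t ^ Suc i * x ^ Suc i"
      using p by (simp add: q_def of_int_poly_simps r(2) ann_def algebra_simps)
    ultimately show ?case by blast
  qed
  then obtain r where r: "\<And>i l. l \<ge> D \<Longrightarrow> coeff (r i) l = 0"
      "\<And>i. poly (of_int_poly (r i)) x = of_int t ^ i * x ^ i"
    by metis
  obtain C E where CE: "\<forall>(J :: nat set) (a :: nat \<Rightarrow> nat \<Rightarrow> int) (H :: int).
    finite J \<and> card J = Suc D \<and> H \<ge> 1 \<and> (\<forall>i<D. \<forall>j\<in>J. \<bar>a i j\<bar> \<le> H) \<longrightarrow>
    (\<exists>x. (\<exists>j\<in>J. x j \<noteq> 0) \<and> (\<forall>i<D. (\<Sum>j\<in>J. a i j * x j) = 0) \<and> (\<forall>j\<in>J. \<bar>x j\<bar> \<le> C * H ^ E))"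
    using integer_system_solution[of D, where 'a = nat] by (elim exE)
  have "\<exists>c>0. \<forall>(S :: int poly) (H :: int). degree S \<le> s \<and> H \<ge> 1 \<and>
    (\<forall>i. \<bar>coeff S i\<bar> \<le> H) \<and> poly (of_int_poly S) x \<noteq> 0 \<longrightarrow>
    c \<le> norm (poly (of_int_poly S) x) * of_int H ^ E" for s
  proof -
    \<comment> \<open>The powers of \<open>t\<close> give all \<open>R i\<close> with
      \<open>i \<le> s + D\<close> the same factor: the value of \<open>R i\<close> at
      \<open>x\<close> is \<open>\<tau> x^i\<close>.\<close>
    define R where "R i = smult (t ^ (s + D - i)) (r i)" for i
    define \<tau> where "\<tau> = t ^ (s + D)"
    have R: "coeff (R i) l = 0" if "l \<ge> D" for i l using r(1)[OF that] by (simp add: R_def)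
    have R_x: "poly (of_int_poly (R i)) x = of_int \<tau> * x ^ i" if "i \<le> s + D" for i
      using that by (simp add: R_def of_int_poly_simps r(2) \<tau>_def flip: power_add)
    define M where "M = (\<Sum>i\<le>s + D. \<Sum>l<D. \<bar>coeff (R i) l\<bar>) + 1"
    have "M \<ge> 1" by (auto simp: M_def intro!: sum_nonneg)
    have M: "\<bar>coeff (R i) l\<bar> \<le> M" if "i \<le> s + D" "l < D" for i l
    proof -
      have "\<bar>coeff (R i) l\<bar> \<le> (\<Sum>l<D. \<bar>coeff (R i) l\<bar>)"
        using that by (intro member_le_sum[of l "{..<D}" "\<lambda>l. \<bar>coeff (R i) l\<bar>"]) auto
      also have "\<dots> \<le> (\<Sum>i\<le>s + D. \<Sum>l<D. \<bar>coeff (R i) l\<bar>)"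
        using that by (intro member_le_sum[of i "{..s + D}" "\<lambda>i. \<Sum>l<D. \<bar>coeff (R i) l\<bar>"])
          (auto intro: sum_nonneg)
      finally show ?thesis by (simp add: M_def)
    qed
    \<comment> \<open>\<open>K\<close> collects the constants of the final estimate; the added ones
      keep it positive.\<close>
    define K where "K = norm (of_int \<tau> :: 'a) * (of_int (\<bar>C\<bar> + 1) * of_int (int (s + 1) * M) ^ E *
      ((\<Sum>j<D. norm x ^ j) + 1))"
    have "\<tau> \<noteq> 0" using t by (simp add: \<tau>_def)
    have "K > 0"
      unfolding K_def using \<open>\<tau> \<noteq> 0\<close> \<open>M \<ge> 1\<close>
      by (intro mult_pos_pos add_nonneg_pos zero_less_power) (auto intro!: sum_nonneg)
    have "1 / K \<le> norm (poly (of_int_poly S) x) * of_int H ^ E"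
      if S: "degree S \<le> s" and H: "H \<ge> 1" and SH: "\<And>i. \<bar>coeff S i\<bar> \<le> H"
        and nz: "poly (of_int_poly S) x \<noteq> 0" for S :: "int poly" and H :: int
    proof -
      \<comment> \<open>\<open>V j\<close> is \<open>\<tau> x^j S(x)\<close> written in the powers
        of \<open>x\<close> below \<open>D\<close>.\<close>
      define V where "V j = (\<Sum>i\<le>s. smult (coeff S i) (R (i + j)))" for j
      \<comment> \<open>Unknowns below \<open>D\<close> are the coefficients of \<open>U\<close>;
        unknown \<open>D\<close> is the integer that \<open>\<tau> S(x) U(x)\<close> is to equal, so
        its column is -1 in the constant row and 0 elsewhere.\<close>
      define a where "a l j = (if j < D then coeff (V j) l else if l = 0 then - 1 else 0)" for l j
      define H' where "H' = int (s + 1) * M * H"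
      have "H' \<ge> 1"
        unfolding H'_def using \<open>M \<ge> 1\<close> H by (smt (verit) mult_le_cancel_left1 of_nat_0_le_iff of_nat_add of_nat_1 mult_less_cancel_right2)
      have a_le: "\<bar>a l j\<bar> \<le> H'" if "l < D" "j \<in> {..D}" for l j
      proof (cases "j < D")
        case True
        have "\<bar>coeff (V j) l\<bar> \<le> (\<Sum>i\<le>s. \<bar>coeff S i\<bar> * \<bar>coeff (R (i + j)) l\<bar>)"
          unfolding V_def coeff_sum coeff_smult abs_mult[symmetric] by (rule sum_abs)
        also have "\<dots> \<le> (\<Sum>i\<le>s. H * M)"
          using SH H that M by (intro sum_mono mult_mono) auto
        finally show ?thesis using True by (simp add: a_def H'_def algebra_simps)
      qed (use \<open>H' \<ge> 1\<close> in \<open>auto simp: a_def\<close>)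
      have "finite {..D} \<and> card {..D} = Suc D \<and> H' \<ge> 1 \<and> (\<forall>i<D. \<forall>j\<in>{..D}. \<bar>a i j\<bar> \<le> H')"
        using a_le \<open>H' \<ge> 1\<close> by simp
      from CE[rule_format, OF this] obtain u where u: "\<exists>j\<in>{..D}. u j \<noteq> 0"
          "\<forall>i<D. (\<Sum>j\<le>D. a i j * u j) = 0" "\<forall>j\<in>{..D}. \<bar>u j\<bar> \<le> C * H' ^ E"
        by (elim exE conjE)
      define U :: "int poly" where "U = (\<Sum>j<D. monom (u j) j)"
      have sum_split: "(\<Sum>j\<le>D. g j) = (\<Sum>j<D. g j) + g D" for g :: "nat \<Rightarrow> int"
        by (simp flip: lessThan_Suc_atMost)
      define W where "W = (\<Sum>j<D. smult (u j) (V j)) - [:u D:]"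
      have "coeff W l = 0" for l
      proof (cases "l < D")
        case True
        have "coeff W l = (\<Sum>j<D. u j * coeff (V j) l) - (if l = 0 then u D else 0)"
          by (simp add: W_def coeff_sum coeff_pCons split: nat.split)
        also have "\<dots> = (\<Sum>j\<le>D. a l j * u j)"
          by (simp add: sum_split) (simp add: a_def mult.commute)
        finally show ?thesis using u(2) True by simp
      next
        case False
        with D have "l > 0" by simp
        with False show ?thesis
          by (simp add: W_def coeff_sum coeff_pCons V_def R split: nat.split)
      qed
      then have "W = 0" by (intro poly_eqI) simp
      have V_x: "poly (of_int_poly (V j)) x = of_int \<tau> * x ^ j * poly (of_int_poly S) x" if "j < D" for j
        using that by (simp add: V_def of_int_poly_simps poly_sum R_x poly_of_int_poly_eq_sum[OF S]
            sum_distrib_left power_add algebra_simps)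
      have U_x: "poly (of_int_poly U) x = (\<Sum>j<D. of_int (u j) * x ^ j)"
        by (simp add: U_def of_int_poly_sum poly_sum map_poly_monom poly_monom)
      have "of_int (u D) = (\<Sum>j<D. of_int (u j) * poly (of_int_poly (V j)) x)"
        using arg_cong[OF \<open>W = 0\<close>, of "\<lambda>W. poly (of_int_poly W) x"]
        by (simp add: W_def of_int_poly_simps poly_sum)
      also have "\<dots> = of_int \<tau> * poly (of_int_poly S) x * poly (of_int_poly U) x"
        by (simp add: V_x U_x sum_distrib_left algebra_simps)
      finally have uD: "of_int (u D) = of_int \<tau> * poly (of_int_poly S) x * poly (of_int_poly U) x" .
      \<comment> \<open>Otherwise \<open>U(x) = 0\<close>, because \<open>\<tau> S(x)\<close> is
        nonzero, and independence would make every unknown vanish.\<close>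
      have "u D \<noteq> 0"
      proof
        assume "u D = 0"
        with uD nz \<open>\<tau> \<noteq> 0\<close> have "poly (of_int_poly U) x = 0" by simp
        moreover have coeff_U: "coeff U i = (if i < D then u i else 0)" for i
          by (simp add: U_def coeff_sum)
        ultimately have "U = 0" by (intro indep) auto
        then have "u i = 0" if "i < D" for i using coeff_U[of i] that by simp
        with \<open>u D = 0\<close> u(1) show False by (metis atMost_iff le_neq_implies_less)
      qed
      then have "1 \<le> norm (of_int (u D) :: 'a)" by simp
      also have "\<dots> = norm (of_int \<tau> :: 'a) * norm (poly (of_int_poly S) x) * norm (poly (of_int_poly U) x)"
        unfolding uD by (simp add: norm_mult)
      also have "norm (poly (of_int_poly U) x) \<le> (\<Sum>j<D. norm (of_int (u j) * x ^ j))"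
        unfolding U_x by (rule norm_sum)
      also have "\<dots> \<le> (\<Sum>j<D. of_int (C * H' ^ E) * norm x ^ j)"
        unfolding norm_mult norm_power using u(3)
        by (intro sum_mono mult_right_mono) (auto simp flip: of_int_abs of_int_mult of_int_power simp del: of_int_mult of_int_power)
      also have "\<dots> = of_int (C * H' ^ E) * (\<Sum>j<D. norm x ^ j)"
        by (simp add: sum_distrib_left)
      also have "\<dots> \<le> of_int ((\<bar>C\<bar> + 1) * H' ^ E) * ((\<Sum>j<D. norm x ^ j) + 1)"
        using \<open>H' \<ge> 1\<close> by (intro mult_mono of_int_le_iff[THEN iffD2] mult_right_mono) (auto intro!: sum_nonneg)
      finally have "1 \<le> norm (of_int \<tau> :: 'a) * norm (poly (of_int_poly S) x) *
          (of_int ((\<bar>C\<bar> + 1) * H' ^ E) * ((\<Sum>j<D. norm x ^ j) + 1))"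
        by (simp add: mult_left_mono)
      also have "\<dots> = K * (norm (poly (of_int_poly S) x) * of_int H ^ E)"
        by (simp add: K_def H'_def power_mult_distrib)
      finally show ?thesis using \<open>K > 0\<close> by (simp add: field_simps)
    qed
    then show ?thesis using \<open>K > 0\<close> by (intro exI[of _ "1 / K"]) auto
  qed
  then show thesis by (rule that)
qed

section \<open>Power series with integer coefficients and their reduction modulo 2\<close>

definition of_int_fps :: "int fps \<Rightarrow> 'a::comm_ring_1 fps" where
  "of_int_fps F = Abs_fps (\<lambda>n. of_int (F $ n))"

lemma of_int_fps_nth [simp]: "of_int_fps F $ n = of_int (F $ n)"
  by (simp add: of_int_fps_def)

lemma of_int_fps_0: "of_int_fps 0 = 0"
  by (simp add: fps_eq_iff)

lemma of_int_fps_1: "of_int_fps 1 = 1"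
  by (simp add: fps_eq_iff)

lemma of_int_fps_add: "of_int_fps (F + G) = of_int_fps F + of_int_fps G"
  by (simp add: fps_eq_iff)

lemma of_int_fps_mult: "of_int_fps (F * G) = of_int_fps F * of_int_fps G"
  by (simp add: fps_eq_iff fps_mult_nth)

lemma of_int_fps_power: "of_int_fps (F ^ n) = of_int_fps F ^ n"
  by (induction n) (simp_all add: of_int_fps_1 of_int_fps_mult)

lemma of_int_fps_sum: "of_int_fps (sum F I) = (\<Sum>i\<in>I. of_int_fps (F i))"
  by (simp add: fps_eq_iff fps_sum_nth)

lemma of_int_fps_of_poly: "of_int_fps (fps_of_poly p) = fps_of_poly (of_int_poly p)"
  by (simp add: fps_eq_iff coeff_map_poly)

lemmas of_int_fps_simps =
  of_int_fps_0 of_int_fps_1 of_int_fps_add of_int_fps_mult of_int_fps_power of_int_fps_sum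
  of_int_fps_of_poly

lemma of_int_fps_eq_iff:
  "(of_int_fps F :: 'a :: {comm_ring_1, ring_char_0} fps) = of_int_fps G \<longleftrightarrow> F = G"
  by (simp add: fps_eq_iff)

lemma of_int_bit: "(of_int x :: bit) = (if even x then 0 else 1)"
proof (cases "even x")
  case False
  then obtain k where "x = 2 * k + 1" by (elim oddE)
  then show ?thesis by simp
qed (auto elim!: evenE)

lemma of_int_fps_bit: "of_int_fps (Abs_fps f) = fps_mod2 f"
  by (simp add: fps_eq_iff fps_mod2_def of_int_bit)

lemma CHAR_bit: "CHAR(bit) = 2"
proof (rule CHAR_eqI)
  show "2 dvd n" if "of_nat n = (0 :: bit)" for n
    using that of_int_bit[of "int n"] by (auto split: if_splits)
qed simp

text \<open>Frobenius in characteristic 2, together with \<open>x^2 = x\<close> in the field itself.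
  Truncation to a polynomial lets the freshman's dream for finite sums apply.\<close>

lemma bit_fps_square_nth: "(F\<^sup>2 :: bit fps) $ n = (if even n then F $ (n div 2) else 0)"
proof -
  have square: "x\<^sup>2 = x" for x :: bit by (cases x) auto
  define p where "p = (\<Sum>i\<le>n. monom (F $ i) i)"
  have p: "coeff p i = F $ i" if "i \<le> n" for i
    using that by (simp add: p_def coeff_sum)
  have "F\<^sup>2 $ n = coeff (p\<^sup>2) n"
    by (simp add: power2_eq_square fps_mult_nth coeff_mult p atLeast0AtMost)
  also have "p\<^sup>2 = (\<Sum>i\<le>n. monom (F $ i) i ^ 2)"
    unfolding p_def by (rule freshmans_dream_sum) (simp_all add: CHAR_bit)
  also have "coeff \<dots> n = (\<Sum>i\<le>n. if 2 * i = n then F $ i else 0)"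
    by (simp add: coeff_sum monom_power square mult.commute[of 2] del: power_bit_unfold)
  also have "\<dots> = (if even n then F $ (n div 2) else 0)"
  proof (cases "even n")
    case True
    then have "(\<Sum>i\<le>n. if 2 * i = n then F $ i else 0) = (\<Sum>i\<le>n. if n div 2 = i then F $ i else 0)"
      by (intro sum.cong if_cong) auto
    then show ?thesis using True by (simp only: sum.delta finite_atMost) simp
  next
    case False
    then show ?thesis by (auto intro!: sum.neutral)
  qed
  finally show ?thesis .
qed

text \<open>There are \<open>(s + 1) * (N + 1)\<close> free coefficients and one linear condition
  fewer.\<close>

lemma auxiliary_form:
  fixes F :: "int fps" and s N :: nat
  obtains P :: "nat \<Rightarrow> int poly" where "\<And>j. degree (P j) \<le> N" "\<exists>j\<le>s. \<exists>i. odd (coeff (P j) i)"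
    "\<And>n. n < (s + 1) * (N + 1) - 1 \<Longrightarrow> (\<Sum>j\<le>s. fps_of_poly (P j) * F ^ j) $ n = 0"
proof -
  define J where "J = {..s} \<times> {..N}"
  define a where "a n = (\<lambda>(j, i). (fps_X ^ i * F ^ j) $ n)" for n
  have J: "finite J" "(s + 1) * (N + 1) - 1 < card J" by (simp_all add: J_def)
  obtain x where x: "\<exists>j\<in>J. odd (x j)"
      "\<And>i. i < (s + 1) * (N + 1) - 1 \<Longrightarrow> (\<Sum>j\<in>J. a i j * x j) = 0"
    using integer_system_odd_solution[OF J, of a] by blast
  define P where "P j = (\<Sum>i\<le>N. monom (x (j, i)) i)" for j
  show thesis
  proof
    show "degree (P j) \<le> N" for j
      by (intro degree_le) (auto simp: P_def coeff_sum)
    from x(1) obtain j i where ji: "j \<le> s" "i \<le> N" "odd (x (j, i))" by (auto simp: J_def)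
    then have "coeff (P j) i = x (j, i)" by (simp add: P_def coeff_sum)
    with ji show "\<exists>j\<le>s. \<exists>i. odd (coeff (P j) i)" by metis
    fix n assume n: "n < (s + 1) * (N + 1) - 1"
    have "(fps_of_poly (P j) * F ^ j) $ n = (\<Sum>i\<le>N. a n (j, i) * x (j, i))" for j
      by (simp add: P_def fps_of_poly_sum fps_of_poly_monom sum_distrib_right fps_sum_nth a_def mult.assoc)
        (simp add: mult.commute)
    then show "(\<Sum>j\<le>s. fps_of_poly (P j) * F ^ j) $ n = 0"
      using x(2)[OF n] by (simp add: fps_sum_nth J_def sum.cartesian_product)
  qed
qed

text \<open>The product \<open>e e'\<close> of the form and its conjugate is a polynomial \<open>Z\<close> of degree at most \<open>2 N + d\<close>.\<close>

lemma quadratic_fps_order_bound: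
  fixes F :: "'a :: field fps" and A B C p q :: "'a poly"
  assumes eq: "fps_of_poly A + fps_of_poly B * F + fps_of_poly C * F\<^sup>2 = 0" and "B \<noteq> 0"
    and irrat: "\<And>P Q. Q \<noteq> 0 \<Longrightarrow> fps_of_poly Q * F \<noteq> fps_of_poly P"
    and deg: "degree A \<le> d" "degree B \<le> d" "degree C \<le> d" "degree p \<le> N" "degree q \<le> N"
    and nz: "p \<noteq> 0 \<or> q \<noteq> 0"
  shows "fps_of_poly p + fps_of_poly q * F \<noteq> 0"
    and "subdegree (fps_of_poly p + fps_of_poly q * F) \<le> 2 * N + d"
proof -
  define e where "e = fps_of_poly p + fps_of_poly q * F"
  \<comment> \<open>\<open>e'\<close> is \<open>C\<close> times the conjugate of \<open>e\<close>:
    the other root of the quadratic is \<open>- B / C - F\<close>. Thus \<open>Z\<close> is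
    \<open>C\<close> times the norm of \<open>e\<close>.\<close>
  define e' where "e' = fps_of_poly (C * p - B * q) - fps_of_poly (C * q) * F"
  define Z where "Z = C * p\<^sup>2 - B * p * q + A * q\<^sup>2"
  have AF: "fps_of_poly A = - (fps_of_poly B * F + fps_of_poly C * F\<^sup>2)"
    using eq by (simp add: add_eq_0_iff2 add.assoc)
  have Z: "fps_of_poly Z = e * e'"
    unfolding Z_def e_def e'_def fps_of_poly_simps AF
    by (simp add: algebra_simps power2_eq_square)
  have e: "e \<noteq> 0"
  proof
    assume "e = 0"
    then have qF: "fps_of_poly q * F = fps_of_poly (- p)"
      by (simp add: e_def fps_of_poly_uminus add_eq_0_iff)
    then have "q = 0" using irrat by blast
    with qF nz show False using fps_of_poly_eq_iff[of 0 "- p"] by simp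
  qed
  have "C \<noteq> 0"
  proof
    assume "C = 0"
    with AF have "fps_of_poly B * F = fps_of_poly (- A)" by (simp add: fps_of_poly_uminus)
    with irrat \<open>B \<noteq> 0\<close> show False by blast
  qed
  have "e' \<noteq> 0"
  proof
    assume "e' = 0"
    then have "C * q = 0" using irrat unfolding e'_def by (metis eq_iff_diff_eq_0)
    with \<open>C \<noteq> 0\<close> have q: "q = 0" by simp
    with \<open>e' = 0\<close> have "C * p = 0" using fps_of_poly_eq_iff[of "C * p" 0] by (simp add: e'_def)
    with \<open>C \<noteq> 0\<close> q nz show False by simp
  qed
  have "degree (C * p\<^sup>2) \<le> 2 * N + d" "degree (B * p * q) \<le> 2 * N + d" "degree (A * q\<^sup>2) \<le> 2 * N + d"
    using deg degree_power_le[of p 2] degree_power_le[of q 2]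
      degree_mult_le[of C "p\<^sup>2"] degree_mult_le[of A "q\<^sup>2"]
      degree_mult_le[of "B * p" q] degree_mult_le[of B p] by linarith+
  then have "degree Z \<le> 2 * N + d"
    unfolding Z_def by (intro degree_add_le degree_diff_le)
  moreover have "Z \<noteq> 0" using Z e \<open>e' \<noteq> 0\<close> by auto
  \<comment> \<open>A nonzero polynomial vanishes at 0 to order at most its degree, and the order of
    \<open>e\<close> is at most that of the product \<open>e e'\<close>.\<close>
  ultimately have "subdegree (fps_of_poly Z) \<le> 2 * N + d"
    by (intro order_trans[OF subdegree_leI[of _ "degree Z"]]) auto
  then show "subdegree (fps_of_poly p + fps_of_poly q * F) \<le> 2 * N + d"
    using e \<open>e' \<noteq> 0\<close> by (simp add: Z flip: e_def)
  show "fps_of_poly p + fps_of_poly q * F \<noteq> 0" using e by (simp add: e_def)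
qed

section \<open>The functional equation modulo 2\<close>

definition fps_square_arg :: "'a::zero fps \<Rightarrow> 'a fps" where
  "fps_square_arg F = Abs_fps (\<lambda>n. if even n then F $ (n div 2) else 0)"

lemma eval_fps_square_arg:
  fixes F :: "'a :: {banach, real_normed_field} fps"
  assumes "fps_conv_radius F \<ge> 1"
  shows "fps_conv_radius (fps_square_arg F) \<ge> 1"
    and "norm z < 1 \<Longrightarrow> eval_fps (fps_square_arg F) z = eval_fps F (z\<^sup>2)"
proof -
  have sums: "(\<lambda>n. (fps_square_arg F) $ n * z ^ n) sums eval_fps F (z\<^sup>2)" if "norm z < 1" for z
  proof -
    have "norm (z\<^sup>2) < 1" using that by (simp add: norm_power power_less_one_iff)
    then have "ereal (norm (z\<^sup>2)) < fps_conv_radius F"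
      using assms by (metis less_le_trans ereal_less(3))
    then have "(\<lambda>n. F $ n * (z\<^sup>2) ^ n) sums eval_fps F (z\<^sup>2)" by (rule sums_eval_fps)
    then have *: "(\<lambda>n. (fps_square_arg F) $ (2 * n) * z ^ (2 * n)) sums eval_fps F (z\<^sup>2)"
      by (simp add: fps_square_arg_def power_mult)
    have "strict_mono (\<lambda>n :: nat. 2 * n)" by (simp add: strict_mono_def)
    moreover have "(fps_square_arg F) $ n * z ^ n = 0" if "n \<notin> range (\<lambda>n. 2 * n)" for n
      using that by (auto simp: fps_square_arg_def elim!: dvdE)
    ultimately show ?thesis
      using sums_mono_reindex[of "\<lambda>n. 2 * n" "\<lambda>n. (fps_square_arg F) $ n * z ^ n"] * by blast
  qed
  show "fps_conv_radius (fps_square_arg F) \<ge> 1"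
    unfolding fps_conv_radius_def
    by (rule conv_radius_geI_ex', rule sums_summable, rule sums) auto
  show "eval_fps (fps_square_arg F) z = eval_fps F (z\<^sup>2)" if "norm z < 1"
    unfolding eval_fps_def[of "fps_square_arg F"] using sums[OF that] by (rule sums_unique[symmetric])
qed

text \<open>Uniqueness of power series expansions turns the analytic equation into an identity
  between integer coefficients, which can be reduced modulo 2; there the series in
  \<open>z^2\<close> becomes the square of \<open>F\<close>.\<close>

lemma Mahler_equation_mod2:
  fixes F :: "int fps" and A B C :: "int poly"
  assumes conv: "fps_conv_radius (of_int_fps F :: complex fps) \<ge> 1"
    and funeq: "\<And>z :: complex. norm z < 1 \<Longrightarrow> poly (of_int_poly A) z
      + poly (of_int_poly B) z * eval_fps (of_int_fps F) z
      + poly (of_int_poly C) z * eval_fps (of_int_fps F) (z\<^sup>2) = 0"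
  shows "fps_of_poly (of_int_poly A :: bit poly) + fps_of_poly (of_int_poly B) * of_int_fps F
      + fps_of_poly (of_int_poly C) * (of_int_fps F)\<^sup>2 = 0"
proof -
  define G where "G = fps_square_arg F"
  have G: "of_int_fps G = fps_square_arg (of_int_fps F :: 'a fps)" for dummy :: "'a :: field itself"
    by (simp add: fps_eq_iff G_def fps_square_arg_def)
  define E where "E = fps_of_poly A + fps_of_poly B * F + fps_of_poly C * G"
  have E_nth: "E $ n = 0" for n
  proof -
    let ?F = "of_int_fps F :: complex fps"
    have mult: "fps_conv_radius (fps_of_poly p * H) \<ge> 1" if "fps_conv_radius H \<ge> 1" for p and H :: "complex fps"
      using fps_conv_radius_mult[of "fps_of_poly p" H] that by simp
    have rG: "fps_conv_radius (of_int_fps G :: complex fps) \<ge> 1"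
      unfolding G by (rule eval_fps_square_arg[OF conv])
    have r1: "fps_conv_radius (fps_of_poly (of_int_poly A) + fps_of_poly (of_int_poly B) * ?F) \<ge> 1"
      by (rule order_trans[OF _ fps_conv_radius_add]) (simp add: mult conv)
    have rE: "fps_conv_radius (of_int_fps E :: complex fps) \<ge> 1"
      unfolding E_def of_int_fps_simps
      by (rule order_trans[OF _ fps_conv_radius_add]) (simp add: mult rG r1)
    have "eval_fps (of_int_fps E) z = 0" if "norm z < 1" for z :: complex
    proof -
      have less: "ereal (norm z) < fps_conv_radius H" if "fps_conv_radius H \<ge> 1" for H :: "complex fps"
        using \<open>norm z < 1\<close> that by (metis less_le_trans ereal_less(3))
      have "eval_fps (of_int_fps E) z = poly (of_int_poly A) z
          + poly (of_int_poly B) z * eval_fps ?F z + poly (of_int_poly C) z * eval_fps (of_int_fps G) z"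
        unfolding E_def of_int_fps_simps
        by (simp add: eval_fps_add eval_fps_mult less r1 mult rG conv)
      then show ?thesis using funeq[OF that] eval_fps_square_arg(2)[OF conv that] by (simp add: G)
    qed
    moreover have "eventually (\<lambda>z :: complex. z \<in> ball 0 1) (nhds 0)"
      by (intro eventually_nhds_in_open) auto
    ultimately have "eventually (\<lambda>z. eval_fps (of_int_fps E) z = eval_fps 0 (z :: complex)) (nhds 0)"
      by (auto elim!: eventually_mono)
    then have "(of_int_fps E :: complex fps) = 0"
      using rE by (intro eval_fps_eqD) (auto intro: less_le_trans[of 0 1])
    then have "(of_int_fps E :: complex fps) $ n = 0" by simp
    then show ?thesis by simp
  qed
  have "of_int_fps E = (0 :: bit fps)" by (simp add: fps_eq_iff E_nth)
  moreover have "of_int_fps G = (of_int_fps F :: bit fps)\<^sup>2"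
    by (simp add: fps_eq_iff G fps_square_arg_def bit_fps_square_nth)
  ultimately show ?thesis by (simp add: E_def of_int_fps_simps)
qed

section \<open>Bounded power series with integer coefficients\<close>

text \<open>Orthogonality of the characters of a cyclic group; sampling at roots of unity takes the
  place of an integral over the circle.\<close>

lemma discrete_Parseval:
  fixes c :: "nat \<Rightarrow> complex" and M :: nat
  defines "e \<equiv> \<lambda>k :: nat. cis (2 * pi * real k / real M)"
  assumes "M > 0"
  shows "(\<Sum>k<M. (cmod (\<Sum>n<M. c n * e k ^ n))\<^sup>2) = real M * (\<Sum>n<M. (cmod (c n))\<^sup>2)"
proof -
  \<comment> \<open>The symmetry \<open>e k ^ n = e n ^ k\<close> turns the sum over
    \<open>k\<close> into a geometric sum.\<close>
  have e_swap: "(c n * e k ^ n) * cnj (c m * e k ^ m) = c n * cnj (c m) * (e n * cnj (e m)) ^ k" for k n m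
    by (simp add: e_def Complex.DeMoivre cis_cnj power_mult_distrib mult_ac)
  have e_M: "e n ^ M = 1" for n
    using \<open>M > 0\<close> by (simp add: e_def Complex.DeMoivre cis_multiple_2pi)
  have e_inj: "n = m" if "e n = e m" "n < M" "m < M" for n m
    using Complex.bij_betw_roots_unity[OF \<open>M > 0\<close>] that unfolding bij_betw_def inj_on_def e_def by auto
  have e_cnj: "e n * cnj (e n) = 1" for n
    by (simp add: e_def cis_cnj cis_mult)
  have orth: "(\<Sum>k<M. (e n * cnj (e m)) ^ k) = (if n = m then of_nat M else 0)" if "n < M" "m < M" for n m
  proof (cases "n = m")
    case False
    have "e n * cnj (e m) \<noteq> 1"
    proof
      assume "e n * cnj (e m) = 1"
      then have "e n * (e m * cnj (e m)) = e m" by (simp add: mult_ac)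
      with e_inj[OF _ that] False show False by (simp add: e_cnj)
    qed
    moreover have "(e n * cnj (e m)) ^ M = 1"
      by (simp add: power_mult_distrib e_M flip: complex_cnj_power)
    ultimately show ?thesis using False by (simp add: sum_gp_strict)
  qed (simp add: e_cnj)
  have "complex_of_real (\<Sum>k<M. (cmod (\<Sum>n<M. c n * e k ^ n))\<^sup>2) =
      (\<Sum>k<M. \<Sum>n<M. \<Sum>m<M. c n * cnj (c m) * (e n * cnj (e m)) ^ k)"
    unfolding of_real_sum complex_norm_square cnj_sum sum_product
    by (intro sum.cong refl e_swap)
  also have "\<dots> = (\<Sum>n<M. \<Sum>m<M. \<Sum>k<M. c n * cnj (c m) * (e n * cnj (e m)) ^ k)"
    by (rule trans[OF sum.swap sum.cong[OF refl sum.swap]])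
  also have "\<dots> = (\<Sum>n<M. \<Sum>m<M. if n = m then of_nat M * (c n * cnj (c n)) else 0)"
    by (intro sum.cong refl) (auto simp: orth simp flip: sum_distrib_left)
  also have "\<dots> = complex_of_real (real M * (\<Sum>n<M. (cmod (c n))\<^sup>2))"
    by (simp add: sum_distrib_left flip: complex_norm_square)
  finally show ?thesis by (simp only: of_real_eq_iff)
qed

text \<open>Parseval bounds the sum of the squared coefficients by \<open>K^2\<close>, and each
  nonzero integer coefficient contributes at least 1.\<close>

lemma bounded_int_fps_polynomial:
  fixes F :: "int fps"
  assumes conv: "fps_conv_radius (of_int_fps F :: complex fps) \<ge> 1"
    and bounded: "\<And>z :: complex. norm z < 1 \<Longrightarrow> norm (eval_fps (of_int_fps F) z) \<le> K"
  shows "finite {n. F $ n \<noteq> 0}"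
proof -
  \<comment> \<open>On the circle of radius \<open>r < 1\<close> the series is cut off after
    \<open>M\<close> terms and sampled at \<open>M\<close> points. Letting \<open>M\<close> grow
    removes the tail \<open>T M\<close>, which bounds the cutoff error at all sample points;
    \<open>r\<close> tends to 1 afterwards.\<close>
  have disk: "(\<Sum>n<N. (of_int (F $ n) * r ^ n)\<^sup>2) \<le> K\<^sup>2" if r: "0 < r" "r < 1" for N and r :: real
  proof -
    define a where "a n = \<bar>of_int (F $ n)\<bar> * r ^ n" for n
    have conv_r: "ereal (norm w) < fps_conv_radius (of_int_fps F :: complex fps)" if "norm w = r" for w :: complex
      using conv r that by (metis less_le_trans ereal_less(3))
    have "summable (\<lambda>n. norm ((of_int_fps F :: complex fps) $ n * complex_of_real r ^ n))"
      using r by (intro norm_summable_fps conv_r) simp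
    then have sum_a: "summable a"
      using r by (simp add: a_def[abs_def] norm_mult norm_power)
    define T where "T M = suminf a - (\<Sum>n<M. a n)" for M
    have "(\<lambda>M. T M) \<longlonglongrightarrow> suminf a - suminf a"
      unfolding T_def by (intro tendsto_intros summable_LIMSEQ sum_a)
    then have T: "T \<longlonglongrightarrow> 0" by simp
    have "(\<Sum>n<N. (a n)\<^sup>2) \<le> (K + T M)\<^sup>2" if M: "M \<ge> N" "M > 0" for M
    proof -
      define e where "e k = cis (2 * pi * real k / real M)" for k
      define c where "c n = complex_of_real (of_int (F $ n) * r ^ n)" for n
      have cmod_c: "cmod (c n) = a n" for n
        using r unfolding c_def a_def norm_of_real by (simp add: abs_mult)
      have bound: "cmod (\<Sum>n<M. c n * e k ^ n) \<le> K + T M" for k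
      proof -
        define w where "w = of_real r * e k"
        have w: "norm w = r" using r by (simp add: w_def e_def norm_mult)
        define g where "g n = (of_int_fps F :: complex fps) $ n * w ^ n" for n
        have g: "summable g" "suminf g = eval_fps (of_int_fps F) w" "summable (\<lambda>n. norm (g n))"
          using sums_eval_fps[OF conv_r[OF w]] norm_summable_fps[OF conv_r[OF w]]
          by (auto simp: g_def[abs_def] sums_iff)
        have norm_g: "norm (g n) = a n" for n
          by (simp add: g_def a_def norm_mult norm_power w)
        have split: "suminf g = (\<Sum>n. g (n + M)) + (\<Sum>n<M. g n)"
          by (rule suminf_split_initial_segment[OF g(1)])
        have "(\<Sum>n<M. c n * e k ^ n) = (\<Sum>n<M. g n)"
          by (simp add: g_def c_def w_def power_mult_distrib mult.assoc)
        also have "\<dots> = suminf g - (\<Sum>n. g (n + M))" using split by simp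
        also have "cmod \<dots> \<le> cmod (suminf g) + cmod (\<Sum>n. g (n + M))" by (rule norm_triangle_ineq4)
        also have "cmod (suminf g) \<le> K" using bounded[of w] w r g(2) by simp
        also have "cmod (\<Sum>n. g (n + M)) \<le> (\<Sum>n. norm (g (n + M)))"
          by (rule summable_norm) (use g(3) in \<open>simp add: summable_iff_shift[of "\<lambda>n. norm (g n)"]\<close>)
        also have "\<dots> = T M"
          using suminf_split_initial_segment[OF sum_a, of M] by (simp add: norm_g T_def)
        finally show ?thesis by simp
      qed
      have "real M * (\<Sum>n<N. (a n)\<^sup>2) \<le> real M * (\<Sum>n<M. (a n)\<^sup>2)"
        using M by (intro mult_left_mono sum_mono2) auto
      also have "\<dots> = (\<Sum>k<M. (cmod (\<Sum>n<M. c n * e k ^ n))\<^sup>2)"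
        unfolding e_def discrete_Parseval[OF M(2), of c] cmod_c ..
      also have "\<dots> \<le> (\<Sum>k<M. (K + T M)\<^sup>2)"
        using bound by (intro sum_mono power_mono) auto
      also have "\<dots> = real M * (K + T M)\<^sup>2" by simp
      finally show ?thesis using M by simp
    qed
    then have "eventually (\<lambda>M. (\<Sum>n<N. (a n)\<^sup>2) \<le> (K + T M)\<^sup>2) sequentially"
      by (intro eventually_sequentiallyI[of "Suc N"]) auto
    moreover have "(\<lambda>M. (K + T M)\<^sup>2) \<longlonglongrightarrow> (K + 0)\<^sup>2" by (intro tendsto_intros T)
    ultimately have "(\<Sum>n<N. (a n)\<^sup>2) \<le> (K + 0)\<^sup>2"
      by (intro tendsto_lowerbound[of _ _ sequentially]) auto
    then show ?thesis by (simp add: a_def power_mult_distrib)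
  qed
  have sq: "(\<Sum>n<N. (real_of_int (F $ n))\<^sup>2) \<le> K\<^sup>2" for N
  proof -
    have "((\<lambda>r. \<Sum>n<N. (of_int (F $ n) * r ^ n)\<^sup>2) \<longlongrightarrow> (\<Sum>n<N. (of_int (F $ n) * 1 ^ n)\<^sup>2)) (at_left (1 :: real))"
      by (intro tendsto_intros)
    moreover have "eventually (\<lambda>r :: real. (\<Sum>n<N. (of_int (F $ n) * r ^ n)\<^sup>2) \<le> K\<^sup>2) (at_left 1)"
      by (rule eventually_mono[OF eventually_at_left_real[of 0 1]]) (auto intro: disk)
    ultimately show ?thesis by (simp add: tendsto_upperbound)
  qed
  show ?thesis
  proof (rule ccontr)
    assume "\<not> ?thesis"
    then obtain A where A: "A \<subseteq> {n. F $ n \<noteq> 0}" "card A = nat \<lceil>K\<^sup>2\<rceil> + 1" "finite A"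
      by (meson infinite_arbitrarily_large)
    then obtain N where N: "A \<subseteq> {..<N}" using finite_nat_bounded by blast
    have "real (card A) = (\<Sum>n\<in>A. 1)" by simp
    also have "\<dots> \<le> (\<Sum>n\<in>A. (real_of_int (F $ n))\<^sup>2)"
    proof (intro sum_mono)
      fix n assume "n \<in> A"
      then have "1 \<le> \<bar>F $ n\<bar>" using A by auto
      then have "1 \<le> \<bar>real_of_int (F $ n)\<bar>" by linarith
      then show "1 \<le> (real_of_int (F $ n))\<^sup>2" by (metis one_le_power power2_abs)
    qed
    also have "\<dots> \<le> (\<Sum>n<N. (real_of_int (F $ n))\<^sup>2)" using N by (intro sum_mono2) auto
    also have "\<dots> \<le> K\<^sup>2" by (rule sq)
    finally show False using A(2) by linarith
  qed
qed

text \<open>Multiplying by \<open>a s ^ (s - 1)\<close> makes \<open>a s * y\<close> a root of a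
  monic polynomial with coefficients of norm at most \<open>G ^ s\<close>, so it is controlled even
  where \<open>a s\<close> is small.\<close>

lemma leading_coeff_times_root_bound:
  fixes a :: "nat \<Rightarrow> 'a :: real_normed_field"
  assumes zero: "(\<Sum>j\<le>s. a j * y ^ j) = 0" and "s > 0"
    and a: "\<And>j. j \<le> s \<Longrightarrow> norm (a j) \<le> G" and "G \<ge> 1"
  shows "norm (a s * y) \<le> real s * G ^ s"
proof (cases "norm (a s * y) \<ge> 1")
  case True
  define g where "g = a s * y"
  have "0 = a s ^ (s - 1) * (\<Sum>j\<le>s. a j * y ^ j)" using zero by simp
  also have "\<dots> = a s ^ (s - 1) * (a s * y ^ s) + (\<Sum>j<s. a s ^ (s - 1) * (a j * y ^ j))"
    by (simp add: sum_distrib_left distrib_left flip: lessThan_Suc_atMost)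
  also have "a s ^ (s - 1) * (a s * y ^ s) = g ^ s"
    using \<open>s > 0\<close> by (cases s) (simp_all add: g_def power_mult_distrib)
  also have "(\<Sum>j<s. a s ^ (s - 1) * (a j * y ^ j)) = (\<Sum>j<s. a j * a s ^ (s - 1 - j) * g ^ j)"
  proof (intro sum.cong refl)
    fix j assume "j \<in> {..<s}"
    then have "a s ^ (s - 1) = a s ^ (s - 1 - j) * a s ^ j" by (simp flip: power_add)
    then show "a s ^ (s - 1) * (a j * y ^ j) = a j * a s ^ (s - 1 - j) * g ^ j"
      by (simp add: g_def power_mult_distrib)
  qed
  finally have "g ^ s + (\<Sum>j<s. a j * a s ^ (s - 1 - j) * g ^ j) = 0" ..
  then have g_s: "g ^ s = - (\<Sum>j<s. a j * a s ^ (s - 1 - j) * g ^ j)" by (simp only: eq_neg_iff_add_eq_0)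
  have "norm g ^ s = norm (\<Sum>j<s. a j * a s ^ (s - 1 - j) * g ^ j)"
    unfolding norm_power[symmetric] g_s by (rule norm_minus_cancel)
  also have "\<dots> \<le> (\<Sum>j<s. norm (a j) * norm (a s) ^ (s - 1 - j) * norm g ^ j)"
    by (rule order_trans[OF norm_sum]) (simp add: norm_mult norm_power)
  also have "\<dots> \<le> (\<Sum>j<s. G ^ s * norm g ^ (s - 1))"
  proof (intro sum_mono mult_mono)
    fix j assume j: "j \<in> {..<s}"
    have "norm (a j) * norm (a s) ^ (s - 1 - j) \<le> G * G ^ (s - 1 - j)"
      using a j \<open>G \<ge> 1\<close> by (intro mult_mono power_mono) auto
    also have "\<dots> = G ^ Suc (s - 1 - j)" by simp
    also have "\<dots> \<le> G ^ s" using j \<open>G \<ge> 1\<close> by (intro power_increasing) auto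
    finally show "norm (a j) * norm (a s) ^ (s - 1 - j) \<le> G ^ s" .
    show "norm g ^ j \<le> norm g ^ (s - 1)"
      using True j by (intro power_increasing) (auto simp: g_def)
  qed (use \<open>G \<ge> 1\<close> in auto)
  also have "\<dots> = real s * G ^ s * norm g ^ (s - 1)" by simp
  finally have "norm g * norm g ^ (s - 1) \<le> real s * G ^ s * norm g ^ (s - 1)"
    using \<open>s > 0\<close> by (simp flip: power_Suc)
  moreover have "norm g ^ (s - 1) > 0" using True unfolding g_def by (intro zero_less_power) linarith
  ultimately have "norm g \<le> real s * G ^ s" by (rule mult_right_le_imp_le)
  then show ?thesis by (simp add: g_def)
next
  case False
  have "1 * 1 \<le> real s * G ^ s"
    using \<open>s > 0\<close> \<open>G \<ge> 1\<close> by (intro mult_mono) auto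
  with False show ?thesis by linarith
qed

text \<open>Reducing \<open>Q\<close> directly could give 0. Its primitive part \<open>Q'\<close>
  stays nonzero modulo 2, and \<open>Q' F\<close> is still a polynomial, since its multiple by the
  content of \<open>Q\<close> is \<open>P\<close>.\<close>

lemma rational_mod2I:
  fixes F :: "int fps" and P Q :: "int poly"
  assumes "Q \<noteq> 0" "fps_of_poly Q * F = fps_of_poly P"
  shows "\<exists>P Q :: bit poly. Q \<noteq> 0 \<and> fps_of_poly Q * of_int_fps F = fps_of_poly P"
proof -
  define Q' where "Q' = primitive_part Q"
  define G where "G = fps_of_poly Q' * F"
  have "Q = smult (content Q) Q'" by (simp add: Q'_def)
  then have "fps_of_poly Q = fps_const (content Q) * fps_of_poly Q'" by (metis fps_of_poly_smult)
  with assms(2) have "fps_const (content Q) * G = fps_of_poly P"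
    by (simp add: G_def mult.assoc)
  then have "content Q * G $ n = coeff P n" for n by (metis fps_mult_left_const_nth fps_of_poly_nth)
  then have G0: "G $ n = 0" if "n > degree P" for n
    using that assms(1) by (metis coeff_eq_0 content_eq_zero_iff mult_eq_0_iff)
  define R where "R = (\<Sum>n\<le>degree P. monom (G $ n) n)"
  have "fps_of_poly R = G"
    using G0 by (auto simp: fps_eq_iff R_def coeff_sum not_le)
  then have "fps_of_poly Q' * F = fps_of_poly R" by (simp add: G_def)
  then have "of_int_fps (fps_of_poly Q' * F) = (of_int_fps (fps_of_poly R) :: bit fps)" by simp
  then have "fps_of_poly (of_int_poly Q') * of_int_fps F = fps_of_poly (of_int_poly R :: bit poly)"
    by (simp add: of_int_fps_simps)
  moreover have "of_int_poly Q' \<noteq> (0 :: bit poly)"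
  proof
    assume *: "of_int_poly Q' = (0 :: bit poly)"
    have "even (coeff Q' i)" for i
    proof -
      have "coeff (of_int_poly Q' :: bit poly) i = 0" by (simp add: *)
      then show ?thesis by (simp add: coeff_map_poly of_int_bit split: if_splits)
    qed
    then have "2 dvd content Q'" by (simp add: const_poly_dvd_iff flip: const_poly_dvd_iff_dvd_content)
    then show False using assms(1) by (simp add: Q'_def content_primitive_part)
  qed
  ultimately show ?thesis by blast
qed

section \<open>Polynomial forms in \<open>F\<close> and their nonvanishing\<close>

lemma eval_polynomial_form:
  fixes F :: "'a :: {banach, real_normed_field} fps"
  assumes conv: "fps_conv_radius F \<ge> 1"
  shows "fps_conv_radius (\<Sum>j\<le>s. fps_of_poly (P j) * F ^ j) \<ge> 1"
    and "norm z < 1 \<Longrightarrow> eval_fps (\<Sum>j\<le>s. fps_of_poly (P j) * F ^ j) z = (\<Sum>j\<le>s. poly (P j) z * eval_fps F z ^ j)"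
proof -
  have less: "ereal (norm z) < fps_conv_radius H" if "norm z < 1" "fps_conv_radius H \<ge> 1" for H :: "'a fps"
    using that by (metis less_le_trans ereal_less(3))
  have term_r: "fps_conv_radius (fps_of_poly p * F ^ j) \<ge> 1" for p j
    using order_trans[OF _ fps_conv_radius_mult[of "fps_of_poly p" "F ^ j"]]
      order_trans[OF conv fps_conv_radius_power[of F j]] by simp
  have term_eval: "eval_fps (fps_of_poly p * F ^ j) z = poly p z * eval_fps F z ^ j" if "norm z < 1" for p j
    using order_trans[OF conv fps_conv_radius_power[of F j]] conv less[OF that]
    by (simp add: eval_fps_mult eval_fps_power)
  have "fps_conv_radius (\<Sum>j\<le>s. fps_of_poly (P j) * F ^ j) \<ge> 1 \<and>
     (norm z < 1 \<longrightarrow> eval_fps (\<Sum>j\<le>s. fps_of_poly (P j) * F ^ j) z = (\<Sum>j\<le>s. poly (P j) z * eval_fps F z ^ j))"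
  proof (induction s)
    case 0
    then show ?case using term_r[of _ 0] term_eval[of _ 0] by simp
  next
    case (Suc s)
    have "fps_conv_radius (\<Sum>j\<le>Suc s. fps_of_poly (P j) * F ^ j) \<ge> 1"
      using Suc term_r[of "P (Suc s)" "Suc s"] unfolding sum.atMost_Suc
      by (intro order_trans[OF _ fps_conv_radius_add]) simp
    moreover have "eval_fps (\<Sum>j\<le>Suc s. fps_of_poly (P j) * F ^ j) z = (\<Sum>j\<le>Suc s. poly (P j) z * eval_fps F z ^ j)"
      if "norm z < 1"
      using Suc term_r[of "P (Suc s)" "Suc s"] term_eval[OF that] that
      by (simp add: eval_fps_add less del: power_Suc)
    ultimately show ?case by blast
  qed
  then show "fps_conv_radius (\<Sum>j\<le>s. fps_of_poly (P j) * F ^ j) \<ge> 1"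
    and "norm z < 1 \<Longrightarrow> eval_fps (\<Sum>j\<le>s. fps_of_poly (P j) * F ^ j) z = (\<Sum>j\<le>s. poly (P j) z * eval_fps F z ^ j)"
    by auto
qed

text \<open>Induction on \<open>s\<close> reduces to a nonzero top coefficient. If the form
  vanished, the root bound would make this coefficient times \<open>F\<close> bounded on the disk,
  hence a polynomial, and \<open>F\<close> rational modulo 2.\<close>

lemma polynomial_form_nonzero:
  fixes F :: "int fps" and P :: "nat \<Rightarrow> int poly"
  assumes conv: "fps_conv_radius (of_int_fps F :: complex fps) \<ge> 1"
    and irrat: "\<And>P Q :: bit poly. Q \<noteq> 0 \<Longrightarrow> fps_of_poly Q * of_int_fps F \<noteq> fps_of_poly P"
    and "\<exists>j\<le>s. P j \<noteq> 0"
  shows "(\<Sum>j\<le>s. fps_of_poly (P j) * F ^ j) \<noteq> 0"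
  using \<open>\<exists>j\<le>s. P j \<noteq> 0\<close>
proof (induction s)
  case 0
  then show ?case by (simp flip: fps_of_poly_0)
next
  case (Suc s)
  show ?case
  proof (cases "P (Suc s) = 0")
    case True
    with Suc.prems have "\<exists>j\<le>s. P j \<noteq> 0" by (metis le_Suc_eq)
    with Suc.IH True show ?thesis by simp
  next
    case False
    show ?thesis
    proof
      assume eq: "(\<Sum>j\<le>Suc s. fps_of_poly (P j) * F ^ j) = 0"
      let ?F = "of_int_fps F :: complex fps"
      \<comment> \<open>\<open>G\<close> dominates every \<open>P j\<close> on the unit disk; the
        summand 1 secures \<open>G \<ge> 1\<close>.\<close>
      define G where "G = (\<Sum>j\<le>Suc s. \<Sum>i\<le>degree (P j). \<bar>of_int (coeff (P j) i)\<bar>) + (1 :: real)"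
      define H where "H = fps_of_poly (P (Suc s)) * F"
      have rad: "fps_conv_radius (of_int_fps H :: complex fps) \<ge> 1"
        unfolding H_def of_int_fps_simps
        using fps_conv_radius_mult[of "fps_of_poly (of_int_poly (P (Suc s)))" ?F] conv by simp
      have "norm (eval_fps (of_int_fps H) z) \<le> real (Suc s) * G ^ Suc s" if z: "norm z < 1" for z :: complex
      proof -
        have "(\<Sum>j\<le>Suc s. poly (of_int_poly (P j)) z * eval_fps ?F z ^ j) = 0"
          using arg_cong[OF eq, of "\<lambda>H. eval_fps (of_int_fps H) z"]
          by (simp only: of_int_fps_simps eval_polynomial_form(2)[OF conv z] eval_fps_0)
        moreover have "norm (poly (of_int_poly (P j)) z) \<le> G" if "j \<le> Suc s" for j
        proof -
          have "norm (poly (of_int_poly (P j)) z) \<le> (\<Sum>i\<le>degree (P j). norm (of_int (coeff (P j) i) * z ^ i))"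
            unfolding poly_of_int_poly_eq_sum[OF order_refl] by (rule norm_sum)
          also have "\<dots> \<le> (\<Sum>i\<le>degree (P j). \<bar>of_int (coeff (P j) i)\<bar> * 1)"
            unfolding norm_mult norm_power using z
            by (intro sum_mono mult_mono) (auto intro: power_le_one)
          also have "\<dots> \<le> G"
            using that member_le_sum[of j "{..Suc s}" "\<lambda>j. \<Sum>i\<le>degree (P j). \<bar>real_of_int (coeff (P j) i)\<bar>"]
            by (simp add: G_def sum_nonneg)
          finally show ?thesis .
        qed
        moreover have "G \<ge> 1" by (auto simp: G_def intro!: sum_nonneg add_nonneg_nonneg)
        ultimately have "norm (poly (of_int_poly (P (Suc s))) z * eval_fps ?F z) \<le> real (Suc s) * G ^ Suc s"
          by (intro leading_coeff_times_root_bound) auto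
        moreover have "ereal (norm z) < fps_conv_radius ?F"
          using z conv by (metis less_le_trans ereal_less(3))
        ultimately show ?thesis by (simp add: H_def of_int_fps_simps eval_fps_mult)
      qed
      then have "finite {n. H $ n \<noteq> 0}" by (rule bounded_int_fps_polynomial[OF rad])
      then obtain N where N: "\<And>n. H $ n \<noteq> 0 \<Longrightarrow> n < N" using finite_nat_bounded by blast
      define R where "R = (\<Sum>n<N. monom (H $ n) n)"
      have "fps_of_poly R = H"
        using N by (auto simp: fps_eq_iff R_def coeff_sum)
      then show False using rational_mod2I[OF False, of F R] irrat unfolding H_def by metis
    qed
  qed
qed

section \<open>Iterating the functional equation\<close>

text \<open>For \<open>degree p \<le> N\<close> and nonzero \<open>x\<close> this is the integer
  \<open>x^N p(1/x)\<close>, the value at \<open>1/x\<close> with its denominator cleared.\<close>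

definition homogenize :: "int poly \<Rightarrow> nat \<Rightarrow> int \<Rightarrow> int" where
  "homogenize p N x = (\<Sum>i\<le>N. coeff p i * x ^ (N - i))"

lemma of_int_homogenize:
  assumes "degree p \<le> N" "x \<noteq> 0"
  shows "(of_int (homogenize p N x) :: 'a :: field_char_0) = of_int x ^ N * poly (of_int_poly p) (1 / of_int x)"
proof -
  have "of_int x ^ (N - i) = of_int x ^ N * (1 / of_int x :: 'a) ^ i" if "i \<le> N" for i
    using that assms(2) by (simp add: power_diff power_one_over field_simps)
  then show ?thesis
    by (simp add: homogenize_def poly_of_int_poly_eq_sum[OF assms(1)] sum_distrib_left mult.left_commute)
qed

lemma homogenize_bound:
  obtains H where "H \<ge> 1" "\<And>x. x \<ge> 1 \<Longrightarrow> \<bar>homogenize p N x\<bar> \<le> H * x ^ N"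
proof
  show "(\<Sum>i\<le>N. \<bar>coeff p i\<bar>) + 1 \<ge> 1" by (simp add: sum_nonneg)
  fix x :: int assume x: "x \<ge> 1"
  have "\<bar>homogenize p N x\<bar> \<le> (\<Sum>i\<le>N. \<bar>coeff p i * x ^ (N - i)\<bar>)"
    unfolding homogenize_def by (rule sum_abs)
  also have "\<dots> \<le> (\<Sum>i\<le>N. \<bar>coeff p i\<bar> * x ^ N)"
    unfolding abs_mult using x by (intro sum_mono mult_left_mono) (auto intro: power_increasing)
  also have "\<dots> \<le> ((\<Sum>i\<le>N. \<bar>coeff p i\<bar>) + 1) * x ^ N"
    using x by (simp add: sum_distrib_right ring_distribs)
  finally show "\<bar>homogenize p N x\<bar> \<le> ((\<Sum>i\<le>N. \<bar>coeff p i\<bar>) + 1) * x ^ N" .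
qed

text \<open>Serves to absorb constants that accumulate over \<open>m\<close> iterations into one
  factor \<open>X m\<close>, which is at least \<open>2^(2^m)\<close>.\<close>

lemma eventually_exponential_le_double_exponential:
  "eventually (\<lambda>m. real c ^ m \<le> 2 ^ 2 ^ m) sequentially"
proof -
  have "(\<lambda>m. real m * (1 / 2) ^ m) \<longlonglongrightarrow> 0" by (rule powser_times_n_limit_0) simp
  then have "(\<lambda>m. real c * (real m * (1 / 2) ^ m)) \<longlonglongrightarrow> real c * 0" by (intro tendsto_intros)
  then have "eventually (\<lambda>m. real c * (real m * (1 / 2) ^ m) < 1) sequentially"
    by (intro order_tendstoD(2)[where y = "real c * 0"]) auto
  then show ?thesis
  proof eventually_elim
    case (elim m)
    then have "real (c * m) < real (2 ^ m)" by (simp add: power_one_over field_simps)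
    then have "c * m \<le> 2 ^ m" by (simp only: of_nat_less_iff)
    have "real c ^ m \<le> (2 ^ c) ^ m" using less_imp_le[OF of_nat_less_two_power[of c, where 'a = real]] by (intro power_mono) auto
    also have "\<dots> = (2 :: real) ^ (c * m)" by (simp add: power_mult)
    also have "\<dots> \<le> 2 ^ 2 ^ m" using \<open>c * m \<le> 2 ^ m\<close> by (intro power_increasing) auto
    finally show ?case .
  qed
qed

text \<open>Alternatives (i) and (ii) both make \<open>B(0)\<close> odd, which yields
  \<open>B_odd\<close>. \<open>C_nonzero\<close> permits solving the equation for the value at the
  squared point.\<close>

locale mahler_number =
  fixes F :: "int fps" and A B C :: "int poly" and b :: int
  assumes conv: "fps_conv_radius (of_int_fps F :: complex fps) \<ge> 1"
    and funeq: "\<And>z :: complex. norm z < 1 \<Longrightarrow> poly (of_int_poly A) z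
      + poly (of_int_poly B) z * eval_fps (of_int_fps F) z
      + poly (of_int_poly C) z * eval_fps (of_int_fps F) (z\<^sup>2) = 0"
    and B_odd: "of_int_poly B \<noteq> (0 :: bit poly)"
    and b: "b \<ge> 2"
    and C_nonzero: "\<And>m. poly (of_int_poly C) (1 / of_int (b ^ 2 ^ m) :: complex) \<noteq> 0"
    and irrational: "\<And>P Q :: bit poly. Q \<noteq> 0 \<Longrightarrow> fps_of_poly Q * of_int_fps F \<noteq> fps_of_poly P"
begin

section \<open>The points \<open>1 / X m\<close> and the values of \<open>F\<close> there\<close>

definition X :: "nat \<Rightarrow> int" where "X m = b ^ 2 ^ m"

definition y :: "nat \<Rightarrow> complex" where "y m = eval_fps (of_int_fps F) (1 / of_int (X m))"

abbreviation \<xi> :: complex where "\<xi> \<equiv> y 0"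

lemma X_ge_2: "X m \<ge> 2"
proof -
  have "b ^ 1 \<le> b ^ 2 ^ m" using b by (intro power_increasing) auto
  with b show ?thesis by (simp add: X_def)
qed

lemma X_Suc: "X (Suc m) = (X m)\<^sup>2"
  by (simp add: X_def mult.commute[of 2] power_mult)

lemma norm_inverse_X: "norm (1 / of_int (X m) :: complex) < 1"
  using X_ge_2[of m] by (simp add: norm_divide)

lemma double_exponential_le_X: "2 ^ 2 ^ m \<le> X m"
  unfolding X_def using b by (intro power_mono) auto

lemma eventually_le_X: "eventually (\<lambda>m. c \<le> real_of_int (X m)) sequentially"
proof (rule eventually_sequentiallyI[of "nat \<lceil>c\<rceil>"])
  fix m assume "m \<ge> nat \<lceil>c\<rceil>"
  then have "c \<le> real m" by linarith
  also have "\<dots> \<le> real (2 ^ 2 ^ m)"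
    unfolding of_nat_le_iff by (intro less_imp_le less_trans[OF less_exp less_exp])
  also have "\<dots> = real_of_int (2 ^ 2 ^ m)" by simp
  also have "\<dots> \<le> real_of_int (X m)" using double_exponential_le_X by (simp only: of_int_le_iff)
  finally show "c \<le> real_of_int (X m)" .
qed

lemma inverse_X_tendsto_0: "(\<lambda>m. 1 / of_int (X m) :: complex) \<longlonglongrightarrow> 0"
proof -
  have "filterlim (\<lambda>m. real_of_int (X m)) at_top sequentially"
    unfolding filterlim_at_top using eventually_le_X by blast
  then have "(\<lambda>m. complex_of_real (1 / real_of_int (X m))) \<longlonglongrightarrow> complex_of_real 0"
    by (intro tendsto_intros) (simp add: tendsto_inverse_0_at_top divide_inverse)
  then show ?thesis by simp
qed

text \<open>At \<open>1 / X m\<close> the equation expresses \<open>y (Suc m)\<close> through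
  \<open>y m\<close>. Each step multiplies the bound by a constant times \<open>X m ^ d\<close>, and
  \<open>X (Suc m) = (X m)^2\<close> makes the exponent \<open>d\<close> reproduce itself, so
  \<open>e\<close> is independent of \<open>m\<close>.\<close>

lemma iterated_equation:
  obtains e where "eventually (\<lambda>m. \<exists>g u v. g \<noteq> 0 \<and> of_int g * y m = of_int u + of_int v * \<xi> \<and>
    \<bar>g\<bar> \<le> X m ^ e \<and> \<bar>u\<bar> \<le> X m ^ e \<and> \<bar>v\<bar> \<le> X m ^ e) sequentially"
proof -
  define d where "d = max (degree A) (max (degree B) (degree C))"
  have d: "degree A \<le> d" "degree B \<le> d" "degree C \<le> d" by (auto simp: d_def)
  obtain HA where HA: "HA \<ge> 1" "\<And>x. x \<ge> 1 \<Longrightarrow> \<bar>homogenize A d x\<bar> \<le> HA * x ^ d"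
    using homogenize_bound[of A d] by blast
  obtain HB where HB: "HB \<ge> 1" "\<And>x. x \<ge> 1 \<Longrightarrow> \<bar>homogenize B d x\<bar> \<le> HB * x ^ d"
    using homogenize_bound[of B d] by blast
  obtain HC where HC: "HC \<ge> 1" "\<And>x. x \<ge> 1 \<Longrightarrow> \<bar>homogenize C d x\<bar> \<le> HC * x ^ d"
    using homogenize_bound[of C d] by blast
  define H where "H = HA + HB + HC"
  have H: "H \<ge> 1" and bounds: "\<And>x. x \<ge> 1 \<Longrightarrow> \<bar>homogenize A d x\<bar> \<le> H * x ^ d"
      "\<And>x. x \<ge> 1 \<Longrightarrow> \<bar>homogenize B d x\<bar> \<le> H * x ^ d" "\<And>x. x \<ge> 1 \<Longrightarrow> \<bar>homogenize C d x\<bar> \<le> H * x ^ d"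
    using HA(1) HB(1) HC(1)
    by (auto simp: H_def intro!: order_trans[OF HA(2)] order_trans[OF HB(2)] order_trans[OF HC(2)] mult_right_mono)
  have ex: "\<exists>g u v. g \<noteq> 0 \<and> of_int g * y m = of_int u + of_int v * \<xi> \<and>
    \<bar>g\<bar> \<le> (2 * H) ^ m * X m ^ d \<and> \<bar>u\<bar> \<le> (2 * H) ^ m * X m ^ d \<and> \<bar>v\<bar> \<le> (2 * H) ^ m * X m ^ d" for m
  proof (induction m)
    case 0
    show ?case using X_ge_2[of 0] by (intro exI[of _ 1] exI[of _ 0]) (auto simp: one_le_power)
  next
    case (Suc m)
    then obtain g u v where guv: "g \<noteq> 0" "of_int g * y m = of_int u + of_int v * \<xi>"
      and le: "\<bar>g\<bar> \<le> (2 * H) ^ m * X m ^ d" "\<bar>u\<bar> \<le> (2 * H) ^ m * X m ^ d" "\<bar>v\<bar> \<le> (2 * H) ^ m * X m ^ d"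
      by blast
    have X: "X m \<ge> 1" "X m \<noteq> 0" using X_ge_2[of m] by auto
    let ?A = "homogenize A d (X m)" and ?B = "homogenize B d (X m)" and ?C = "homogenize C d (X m)"
    \<comment> \<open>\<open>W\<close> bounds each product of a homogenized value with one of
      \<open>g\<close>, \<open>u\<close>, \<open>v\<close>. The constant entry is a sum of two such
      products, and \<open>2 * W\<close> is exactly the bound for \<open>Suc m\<close>.\<close>
    define W where "W = H * X m ^ d * ((2 * H) ^ m * X m ^ d)"
    have W: "2 * W = (2 * H) ^ Suc m * X (Suc m) ^ d"
      by (simp add: W_def X_Suc power2_eq_square power_mult_distrib)
    have prod: "\<bar>p * q\<bar> \<le> W" if "\<bar>p\<bar> \<le> H * X m ^ d" "\<bar>q\<bar> \<le> (2 * H) ^ m * X m ^ d" for p q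
      unfolding W_def abs_mult using that H X by (intro mult_mono) auto
    have W0: "W \<ge> 0" using H X by (simp add: W_def)
    have "poly (of_int_poly A) (1 / of_int (X m)) + poly (of_int_poly B) (1 / of_int (X m)) * y m
        + poly (of_int_poly C) (1 / of_int (X m)) * y (Suc m) = 0"
      using funeq[OF norm_inverse_X[of m]] by (simp add: y_def X_Suc power_one_over)
    then have "of_int (X m) ^ d * (poly (of_int_poly A) (1 / of_int (X m)) + poly (of_int_poly B) (1 / of_int (X m)) * y m
        + poly (of_int_poly C) (1 / of_int (X m)) * y (Suc m)) = 0" by simp
    then have eq: "of_int ?A + of_int ?B * y m + of_int ?C * y (Suc m) = 0"
      by (simp add: of_int_homogenize[OF d(1) X(2)] of_int_homogenize[OF d(2) X(2)]
          of_int_homogenize[OF d(3) X(2)] algebra_simps)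
    have "of_int (?C * g) * y (Suc m) = of_int g * (of_int ?C * y (Suc m))" by simp
    also have "of_int ?C * y (Suc m) = - (of_int ?A + of_int ?B * y m)"
      using eq by (simp only: eq_neg_iff_add_eq_0 add_ac)
    also have "of_int g * - (of_int ?A + of_int ?B * y m) = - (of_int g * of_int ?A) - of_int ?B * (of_int g * y m)"
      by (simp add: algebra_simps)
    also have "\<dots> = of_int (- (?A * g) - ?B * u) + of_int (- (?B * v)) * \<xi>"
      unfolding guv(2) by (simp add: algebra_simps)
    finally have "of_int (?C * g) * y (Suc m) = of_int (- (?A * g) - ?B * u) + of_int (- (?B * v)) * \<xi>" .
    moreover have "?C * g \<noteq> 0"
    proof -
      have "of_int ?C \<noteq> (0 :: complex)"
        unfolding of_int_homogenize[OF d(3) X(2)] using C_nonzero[of m] X(2) by (simp add: X_def)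
      with guv(1) show ?thesis by auto
    qed
    moreover have "\<bar>?C * g\<bar> \<le> 2 * W" "\<bar>- (?B * v)\<bar> \<le> 2 * W" "\<bar>- (?A * g) - ?B * u\<bar> \<le> 2 * W"
      using prod[OF bounds(3)[OF X(1)] le(1)] prod[OF bounds(2)[OF X(1)] le(3)]
        prod[OF bounds(1)[OF X(1)] le(1)] prod[OF bounds(2)[OF X(1)] le(2)] W0 by linarith+
    ultimately show ?case unfolding W by blast
  qed
  have "eventually (\<lambda>m. real (nat (2 * H)) ^ m \<le> 2 ^ 2 ^ m) sequentially"
    by (rule eventually_exponential_le_double_exponential)
  then have "eventually (\<lambda>m. \<exists>g u v. g \<noteq> 0 \<and> of_int g * y m = of_int u + of_int v * \<xi> \<and>
    \<bar>g\<bar> \<le> X m ^ Suc d \<and> \<bar>u\<bar> \<le> X m ^ Suc d \<and> \<bar>v\<bar> \<le> X m ^ Suc d) sequentially"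
  proof eventually_elim
    case (elim m)
    have "real_of_int ((2 * H) ^ m) \<le> real_of_int (2 ^ 2 ^ m)" using elim H by simp
    then have "(2 * H) ^ m \<le> X m" using double_exponential_le_X[of m] by (simp only: of_int_le_iff)
    then have "(2 * H) ^ m * X m ^ d \<le> X m ^ Suc d"
      using X_ge_2[of m] by (simp add: mult_right_mono)
    then show ?case using ex[of m] by (meson order_trans)
  qed
  then show thesis by (rule that)
qed

text \<open>With \<open>r\<close> the order of \<open>G\<close>, the quotient of \<open>G\<close> by
  \<open>z^r\<close> is continuous and nonzero at 0, so \<open>|G(1/X)| X^r\<close> has a positive
  limit; half and twice this limit are the constants.\<close>

lemma eval_at_inverse_X:
  fixes G :: "int fps"
  assumes "G \<noteq> 0" "fps_conv_radius (of_int_fps G :: complex fps) \<ge> 1"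
  obtains c1 c2 :: real where "c1 > 0" "eventually (\<lambda>m.
    c1 \<le> norm (eval_fps (of_int_fps G) (1 / of_int (X m) :: complex)) * real_of_int (X m) ^ subdegree G \<and>
    norm (eval_fps (of_int_fps G) (1 / of_int (X m) :: complex)) * real_of_int (X m) ^ subdegree G \<le> c2) sequentially"
proof -
  let ?G = "of_int_fps G :: complex fps" and ?x = "\<lambda>m. 1 / of_int (X m) :: complex"
  define r where "r = subdegree G"
  have r: "r \<le> subdegree ?G"
    using assms(1) unfolding r_def by (intro subdegree_geI) (auto simp: of_int_fps_eq_iff[of _ 0, unfolded of_int_fps_0])
  define S where "S = fps_shift r ?G"
  have "isCont (eval_fps S) 0"
    using less_le_trans[of 0 1, OF _ assms(2)] by (intro continuous_eval_fps) (simp add: S_def zero_ereal_def)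
  then have "(\<lambda>m. norm (eval_fps S (?x m))) \<longlonglongrightarrow> norm (eval_fps S 0)"
    by (intro tendsto_norm isCont_tendsto_compose[OF _ inverse_X_tendsto_0])
  moreover have "norm (eval_fps S (?x m)) = norm (eval_fps ?G (?x m)) * real_of_int (X m) ^ r" for m
  proof -
    have "ereal (norm (?x m)) < fps_conv_radius ?G"
      using assms(2) norm_inverse_X[of m] by (metis less_le_trans ereal_less(3))
    then have "eval_fps S (?x m) = eval_fps ?G (?x m) / ?x m ^ r"
      unfolding S_def using r X_ge_2[of m] by (subst eval_fps_shift) auto
    then show ?thesis using X_ge_2[of m] by (simp add: norm_divide norm_power norm_mult power_one_over)
  qed
  moreover define l where "l = norm (eval_fps S 0)"
  ultimately have lim: "(\<lambda>m. norm (eval_fps ?G (?x m)) * real_of_int (X m) ^ r) \<longlonglongrightarrow> l" by simp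
  have "l > 0" using assms(1) by (simp add: l_def eval_fps_at_0 S_def r_def)
  then have "eventually (\<lambda>m. l / 2 < norm (eval_fps ?G (?x m)) * real_of_int (X m) ^ r) sequentially"
    by (intro order_tendstoD(1)[OF lim]) simp
  moreover have "eventually (\<lambda>m. norm (eval_fps ?G (?x m)) * real_of_int (X m) ^ r < 2 * l) sequentially"
    using \<open>l > 0\<close> by (intro order_tendstoD(2)[OF lim]) simp
  ultimately have "eventually (\<lambda>m. l / 2 \<le> norm (eval_fps ?G (?x m)) * real_of_int (X m) ^ r \<and>
     norm (eval_fps ?G (?x m)) * real_of_int (X m) ^ r \<le> 2 * l) sequentially"
    by eventually_elim simp
  then show thesis using \<open>l > 0\<close> unfolding r_def by (intro that[of "l / 2" "2 * l"]) auto
qed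

end

section \<open>Linear forms and transcendence\<close>

lemma coeff_linear_power_bound:
  fixes u v W :: int
  assumes "\<bar>u\<bar> \<le> W" "\<bar>v\<bar> \<le> W"
  shows "\<bar>coeff ([:u, v:] ^ j) i\<bar> \<le> (2 * W) ^ j"
proof (induction j arbitrary: i)
  case (Suc j)
  have W: "W \<ge> 0" using assms by linarith
  have step: "\<bar>c * a\<bar> \<le> W * (2 * W) ^ j" if "\<bar>c\<bar> \<le> W" "\<bar>a\<bar> \<le> (2 * W) ^ j" for c a :: int
    unfolding abs_mult using that W by (intro mult_mono) auto
  define a where "a = (case i of 0 \<Rightarrow> 0 | Suc i \<Rightarrow> coeff ([:u, v:] ^ j) i)"
  have "\<bar>a\<bar> \<le> (2 * W) ^ j" using Suc W by (auto simp: a_def split: nat.split)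
  moreover have "coeff ([:u, v:] ^ Suc j) i = u * coeff ([:u, v:] ^ j) i + v * a"
    by (simp add: a_def coeff_pCons split: nat.split)
  moreover have "W * (2 * W) ^ j + W * (2 * W) ^ j = (2 * W) ^ Suc j" by simp
  ultimately show ?case
    using step[OF assms(1) Suc[of i]] step[OF assms(2), of a] by linarith
qed (simp add: coeff_pCons split: nat.split)

context mahler_number
begin

lemma eval_form_at_inverse_X:
  fixes P :: "nat \<Rightarrow> int poly"
  assumes "\<And>j. degree (P j) \<le> N"
  shows "of_int (X m) ^ N * eval_fps (of_int_fps (\<Sum>j\<le>s. fps_of_poly (P j) * F ^ j)) (1 / of_int (X m)) =
    (\<Sum>j\<le>s. of_int (homogenize (P j) N (X m)) * y m ^ j)"
proof -
  have "X m \<noteq> 0" using X_ge_2[of m] by simp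
  then have "of_int (homogenize (P j) N (X m)) = of_int (X m) ^ N * poly (of_int_poly (P j)) (1 / of_int (X m) :: complex)" for j
    by (rule of_int_homogenize[OF assms])
  then show ?thesis
    by (simp only: of_int_fps_simps eval_polynomial_form(2)[OF conv norm_inverse_X] y_def
        sum_distrib_left mult.assoc)
qed

text \<open>The order of the form \<open>P_0 + P_1 F\<close> lies between \<open>2 N\<close> and
  \<open>2 N + d\<close>, and clearing denominators costs \<open>X^N\<close>; this gives size
  \<open>X^(- N + O(1))\<close> from both sides. The loss \<open>e\<close> is chosen before
  \<open>N\<close>; only the threshold for \<open>m\<close> depends on \<open>N\<close>.\<close>

lemma good_approximations:
  obtains e where "\<And>N. eventually (\<lambda>m. \<exists>p q :: int. \<bar>q\<bar> \<le> X m ^ (N + e) \<and>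
    1 \<le> norm (of_int q * \<xi> - of_int p) * real_of_int (X m) ^ (N + e) \<and>
    norm (of_int q * \<xi> - of_int p) * real_of_int (X m) ^ N \<le> real_of_int (X m) ^ e) sequentially"
proof -
  define d where "d = max (degree A) (max (degree B) (degree C))"
  have "degree (of_int_poly p :: bit poly) \<le> degree p" for p
    by (rule degree_le) (simp add: coeff_map_poly coeff_eq_0)
  then have d: "degree (of_int_poly A :: bit poly) \<le> d" "degree (of_int_poly B :: bit poly) \<le> d"
      "degree (of_int_poly C :: bit poly) \<le> d"
    unfolding d_def by (meson max.coboundedI1 max.coboundedI2 order_trans)+
  obtain e0 where e0: "eventually (\<lambda>m. \<exists>g u v. g \<noteq> 0 \<and> of_int g * y m = of_int u + of_int v * \<xi> \<and>
    \<bar>g\<bar> \<le> X m ^ e0 \<and> \<bar>u\<bar> \<le> X m ^ e0 \<and> \<bar>v\<bar> \<le> X m ^ e0) sequentially"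
    by (rule iterated_equation)
  \<comment> \<open>\<open>e0\<close> pays for passing from \<open>y m\<close> to
    \<open>\<xi>\<close>, \<open>d\<close> for the excess of the order over \<open>2 N\<close>, and
    1 for absorbing \<open>H\<close>, \<open>c1\<close>, \<open>c2\<close> into a factor
    \<open>X m\<close>.\<close>
  define e where "e = e0 + d + 1"
  have "eventually (\<lambda>m. \<exists>p q :: int. \<bar>q\<bar> \<le> X m ^ (N + e) \<and>
    1 \<le> norm (of_int q * \<xi> - of_int p) * real_of_int (X m) ^ (N + e) \<and>
    norm (of_int q * \<xi> - of_int p) * real_of_int (X m) ^ N \<le> real_of_int (X m) ^ e) sequentially" for N
  proof -
    obtain P :: "nat \<Rightarrow> int poly" where P: "\<And>j. degree (P j) \<le> N" "\<exists>j\<le>1. \<exists>i. odd (coeff (P j) i)"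
        "\<And>n. n < (1 + 1) * (N + 1) - 1 \<Longrightarrow> (\<Sum>j\<le>1. fps_of_poly (P j) * F ^ j) $ n = 0"
      using auxiliary_form[of N 1 F] by blast
    define G where "G = (\<Sum>j\<le>1. fps_of_poly (P j) * F ^ j)"
    define r where "r = subdegree G"
    \<comment> \<open>Reduction modulo 2 cannot lower the order, so an upper bound on the order of
      \<open>G2\<close> is one for \<open>G\<close>.\<close>
    define G2 :: "bit fps" where "G2 = of_int_fps G"
    have G2: "G2 = fps_of_poly (of_int_poly (P 0)) + fps_of_poly (of_int_poly (P 1)) * of_int_fps F"
      unfolding G2_def G_def of_int_fps_simps by simp
    have "of_int_poly (P 0) \<noteq> (0 :: bit poly) \<or> of_int_poly (P 1) \<noteq> (0 :: bit poly)"
    proof -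
      from P(2) obtain j i where "j \<le> 1" "odd (coeff (P j) i)" by blast
      then have "coeff (of_int_poly (P j) :: bit poly) i \<noteq> 0" by (simp add: coeff_map_poly of_int_bit)
      then have "of_int_poly (P j) \<noteq> (0 :: bit poly)" by auto
      with \<open>j \<le> 1\<close> show ?thesis by (cases "j = 0") (auto simp: le_Suc_eq)
    qed
    moreover have "degree (of_int_poly (P j) :: bit poly) \<le> N" for j
      by (rule degree_le) (use P(1)[of j] in \<open>auto simp: coeff_map_poly coeff_eq_0\<close>)
    ultimately have "G2 \<noteq> 0" "subdegree G2 \<le> 2 * N + d"
      unfolding G2
      using quadratic_fps_order_bound[OF Mahler_equation_mod2[OF conv funeq] B_odd irrational d] by blast+
    moreover from \<open>G2 \<noteq> 0\<close> have "G $ subdegree G2 \<noteq> 0"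
      using nth_subdegree_nonzero[of G2] by (auto simp: G2_def)
    ultimately have r_le: "r \<le> 2 * N + d" and "G \<noteq> 0"
      unfolding r_def by (auto intro: order_trans[OF subdegree_leI])
    then have r_ge: "r \<ge> 2 * N"
      unfolding r_def using P(3) by (intro subdegree_geI) (auto simp: G_def)
    have "fps_conv_radius (of_int_fps G :: complex fps) \<ge> 1"
      unfolding G_def of_int_fps_simps by (rule eval_polynomial_form(1)[OF conv])
    then obtain c1 c2 where c: "c1 > 0" "eventually (\<lambda>m.
        c1 \<le> norm (eval_fps (of_int_fps G) (1 / of_int (X m) :: complex)) * real_of_int (X m) ^ r \<and>
        norm (eval_fps (of_int_fps G) (1 / of_int (X m) :: complex)) * real_of_int (X m) ^ r \<le> c2) sequentially"
      using eval_at_inverse_X[OF \<open>G \<noteq> 0\<close>] unfolding r_def by blast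
    obtain H where H: "H \<ge> 1" "\<And>x. x \<ge> 1 \<Longrightarrow> \<bar>homogenize (P 1) N x\<bar> \<le> H * x ^ N"
      using homogenize_bound[of "P 1" N] by blast
    show ?thesis
      using e0 c(2) eventually_le_X[of "real_of_int H"] eventually_le_X[of "1 / c1"] eventually_le_X[of c2]
    proof eventually_elim
      case (elim m)
      then obtain g u v where guv: "g \<noteq> 0" "of_int g * y m = of_int u + of_int v * \<xi>"
        "\<bar>g\<bar> \<le> X m ^ e0" "\<bar>v\<bar> \<le> X m ^ e0" by blast
      define x where "x = real_of_int (X m)"
      define Z where "Z = norm (eval_fps (of_int_fps G) (1 / of_int (X m) :: complex))"
      define h where "h j = homogenize (P j) N (X m)" for j
      \<comment> \<open>\<open>p\<close> and \<open>q\<close> arise from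
        \<open>g * (h 0 + h 1 * y m)\<close> by substituting \<open>u + v * \<xi>\<close> for
        \<open>g * y m\<close>.\<close>
      define q where "q = h 1 * v"
      define p where "p = - (g * h 0 + h 1 * u)"
      have x: "x \<ge> 2" "X m \<ge> 1" "real_of_int H \<le> x" "1 / c1 \<le> x" "c2 \<le> x" using X_ge_2[of m] elim by (simp_all add: x_def)
      have Z: "c1 \<le> Z * x ^ r" "Z * x ^ r \<le> c2" using elim by (simp_all add: Z_def x_def)
      have "of_int q * \<xi> - of_int p = of_int g * of_int (h 0) + of_int (h 1) * (of_int u + of_int v * \<xi>)"
        by (simp add: p_def q_def algebra_simps)
      also have "\<dots> = of_int g * (of_int (h 0) + of_int (h 1) * y m)"
        unfolding guv(2)[symmetric] by (simp add: algebra_simps)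
      also have "of_int (h 0) + of_int (h 1) * y m =
          of_int (X m) ^ N * eval_fps (of_int_fps G) (1 / of_int (X m))"
        unfolding G_def using eval_form_at_inverse_X[of P N m 1, OF P(1)] by (simp add: h_def)
      finally have L: "norm (of_int q * \<xi> - of_int p) = \<bar>real_of_int g\<bar> * (x ^ N * Z)"
        using x by (simp add: norm_mult norm_power Z_def x_def)
      have "real_of_int \<bar>g\<bar> \<le> real_of_int (X m ^ e0)" using guv(3) by (simp only: of_int_le_iff)
      moreover have "1 \<le> real_of_int \<bar>g\<bar>" using guv(1) by linarith
      ultimately have g: "\<bar>real_of_int g\<bar> \<le> x ^ e0" "1 \<le> \<bar>real_of_int g\<bar>" by (simp_all add: x_def)
      have "\<bar>q\<bar> \<le> H * X m ^ N * X m ^ e0"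
        unfolding q_def h_def abs_mult using H(2)[of "X m"] guv(4) x(2) H(1) by (intro mult_mono) auto
      also have "\<dots> \<le> X m * X m ^ N * X m ^ e0"
        using x(2,3) by (intro mult_right_mono) (auto simp: x_def)
      also have "\<dots> = X m ^ (N + e0 + 1)" by (simp add: power_add)
      also have "\<dots> \<le> X m ^ (N + e)" using x(2) by (intro power_increasing) (auto simp: e_def)
      finally have "\<bar>q\<bar> \<le> X m ^ (N + e)" .
      moreover have "1 \<le> norm (of_int q * \<xi> - of_int p) * x ^ (N + e)"
      proof -
        have "1 \<le> c1 * x" using x(4) c(1) by (simp add: field_simps)
        also have "\<dots> \<le> (Z * x ^ r) * x ^ (2 * N + e - r)"
          using Z(1) x(1) c(1) power_increasing[of 1 "2 * N + e - r" x] r_le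
          by (intro mult_mono) (auto simp: e_def)
        also have "\<dots> = Z * x ^ (2 * N + e)"
          using r_le by (simp add: e_def flip: power_add)
        also have "\<dots> = 1 * (x ^ N * Z) * x ^ (N + e)" by (simp add: power_add mult_2)
        also have "\<dots> \<le> norm (of_int q * \<xi> - of_int p) * x ^ (N + e)"
          unfolding L using g(2) x(1) by (intro mult_right_mono) (auto simp: Z_def)
        finally show ?thesis .
      qed
      moreover have "norm (of_int q * \<xi> - of_int p) * x ^ N \<le> x ^ e"
      proof -
        have "norm (of_int q * \<xi> - of_int p) * x ^ N \<le> x ^ e0 * (x ^ N * Z) * x ^ N"
          unfolding L using g(1) x(1) by (intro mult_right_mono) (auto simp: Z_def)
        also have "\<dots> = x ^ e0 * (Z * x ^ (2 * N))" by (simp add: power_add mult_2)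
        also have "\<dots> \<le> x ^ e0 * (Z * x ^ r)"
          using r_ge x(1) by (intro mult_left_mono power_increasing) (auto simp: Z_def)
        also have "\<dots> \<le> x ^ e0 * x" using Z(2) x(1,5) by (intro mult_left_mono) auto
        also have "\<dots> = x ^ (e0 + 1)" by simp
        also have "\<dots> \<le> x ^ e" using x(1) by (intro power_increasing) (auto simp: e_def)
        finally show ?thesis .
      qed
      ultimately show ?case unfolding x_def by blast
    qed
  qed
  then show thesis by (rule that)
qed

text \<open>The exponent \<open>E\<close> of the Liouville bound is fixed before the degree
  \<open>s\<close>, so \<open>s\<close> may exceed it. Then the order of vanishing, about
  \<open>(s + 1) N\<close>, outgrows the total cost of about \<open>(E + 1) N\<close>.\<close>

lemma transcendental: "\<not> algebraic \<xi>"
proof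
  assume "algebraic \<xi>"
  then obtain E where E: "\<And>s. \<exists>c>0. \<forall>(S :: int poly) (H :: int). degree S \<le> s \<and> H \<ge> 1 \<and>
    (\<forall>i. \<bar>coeff S i\<bar> \<le> H) \<and> poly (of_int_poly S) \<xi> \<noteq> 0 \<longrightarrow>
    c \<le> norm (poly (of_int_poly S) \<xi>) * of_int H ^ E"
    using algebraic_Liouville_bound by blast
  obtain e where e: "eventually (\<lambda>m. \<exists>g u v. g \<noteq> 0 \<and> of_int g * y m = of_int u + of_int v * \<xi> \<and>
    \<bar>g\<bar> \<le> X m ^ e \<and> \<bar>u\<bar> \<le> X m ^ e \<and> \<bar>v\<bar> \<le> X m ^ e) sequentially"
    by (rule iterated_equation)
  \<comment> \<open>With \<open>s = E + 1\<close> the gain is \<open>(E + 2) N\<close> against a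
    cost of \<open>(E + 1) N + O(1)\<close>, and \<open>N\<close> is taken larger than that
    remainder. \<open>X m ^ k\<close> will bound the coefficients of \<open>S\<close>.\<close>
  define s where "s = E + 1"
  define N where "N = e * s + (2 + s + e * s) * E + 2"
  define k where "k = 1 + N + s + e * s"
  obtain c where c: "c > 0" "\<And>(S :: int poly) (H :: int). degree S \<le> s \<Longrightarrow> H \<ge> 1 \<Longrightarrow>
    (\<And>i. \<bar>coeff S i\<bar> \<le> H) \<Longrightarrow> poly (of_int_poly S) \<xi> \<noteq> 0 \<Longrightarrow>
    c \<le> norm (poly (of_int_poly S) \<xi>) * of_int H ^ E"
    using E[of s] by blast
  obtain P :: "nat \<Rightarrow> int poly" where P: "\<And>j. degree (P j) \<le> N" "\<exists>j\<le>s. \<exists>i. odd (coeff (P j) i)"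
      "\<And>n. n < (s + 1) * (N + 1) - 1 \<Longrightarrow> (\<Sum>j\<le>s. fps_of_poly (P j) * F ^ j) $ n = 0"
    using auxiliary_form[of N s F] by blast
  define G where "G = (\<Sum>j\<le>s. fps_of_poly (P j) * F ^ j)"
  define r where "r = subdegree G"
  have "\<exists>j\<le>s. P j \<noteq> 0" using P(2) by (metis coeff_0 even_zero)
  then have "G \<noteq> 0"
    using polynomial_form_nonzero[OF conv, of s P] irrational unfolding G_def by blast
  have "r \<ge> (s + 1) * (N + 1) - 1"
    unfolding r_def using \<open>G \<noteq> 0\<close> P(3) by (intro subdegree_geI) (auto simp: G_def)
  then have r_ge: "r \<ge> (s + 1) * N" using s_def by simp
  have "fps_conv_radius (of_int_fps G :: complex fps) \<ge> 1"
    unfolding G_def of_int_fps_simps by (rule eval_polynomial_form(1)[OF conv])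
  then obtain c1 c2 where c12: "c1 > 0" "eventually (\<lambda>m.
      c1 \<le> norm (eval_fps (of_int_fps G) (1 / of_int (X m) :: complex)) * real_of_int (X m) ^ r \<and>
      norm (eval_fps (of_int_fps G) (1 / of_int (X m) :: complex)) * real_of_int (X m) ^ r \<le> c2) sequentially"
    using eval_at_inverse_X[OF \<open>G \<noteq> 0\<close>] unfolding r_def by blast
  have "\<exists>H\<ge>1. \<forall>x\<ge>1. \<bar>homogenize (P j) N x\<bar> \<le> H * x ^ N" for j
    using homogenize_bound[of "P j" N] by blast
  then obtain Hj where Hj: "\<And>j. Hj j \<ge> 1" "\<And>j x. x \<ge> 1 \<Longrightarrow> \<bar>homogenize (P j) N x\<bar> \<le> Hj j * x ^ N"
    by metis
  define H where "H = (\<Sum>j\<le>s. Hj j)"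
  have H: "H \<ge> 0" unfolding H_def using Hj(1) by (intro sum_nonneg) (meson order_trans zero_le_one)
  have "eventually (\<lambda>m. False) sequentially"
    using e c12(2) eventually_le_X[of "real_of_int H"] eventually_le_X[of "1 + c2 / c"]
  proof eventually_elim
    case (elim m)
    then obtain g u v where guv: "g \<noteq> 0" "of_int g * y m = of_int u + of_int v * \<xi>"
      and le: "\<bar>g\<bar> \<le> X m ^ e" "\<bar>u\<bar> \<le> X m ^ e" "\<bar>v\<bar> \<le> X m ^ e" by blast
    define x where "x = real_of_int (X m)"
    define Z where "Z = norm (eval_fps (of_int_fps G) (1 / of_int (X m) :: complex))"
    define h where "h j = homogenize (P j) N (X m)" for j
    \<comment> \<open>The factors \<open>g ^ (s - j)\<close> homogenize the substitution
      \<open>g y_m = u + v \<xi>\<close>, so that \<open>S(\<xi>)\<close> is exactly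
      \<open>g^s X^N\<close> times the value of \<open>G\<close>.\<close>
    define S where "S = (\<Sum>j\<le>s. smult (h j * g ^ (s - j)) ([:u, v:] ^ j))"
    have X: "X m \<ge> 2" by (rule X_ge_2)
    have x: "x \<ge> 2" "real_of_int H \<le> x" "1 + c2 / c \<le> x" using X elim by (simp_all add: x_def)
    have Z: "c1 \<le> Z * x ^ r" "Z * x ^ r \<le> c2" using elim by (simp_all add: Z_def x_def)
    have term_eq: "of_int (h j) * of_int g ^ (s - j) * (of_int u + of_int v * \<xi>) ^ j = of_int g ^ s * (of_int (h j) * y m ^ j)"
      if "j \<le> s" for j
    proof -
      have "of_int g ^ s = (of_int g ^ (s - j) * of_int g ^ j :: complex)" using that by (simp flip: power_add)
      then show ?thesis by (simp add: power_mult_distrib flip: guv(2))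
    qed
    have "poly (of_int_poly S) \<xi> = (\<Sum>j\<le>s. of_int (h j) * of_int g ^ (s - j) * (of_int u + of_int v * \<xi>) ^ j)"
      by (simp add: S_def of_int_poly_simps poly_sum mult.commute[of \<xi>])
    also have "\<dots> = (\<Sum>j\<le>s. of_int g ^ s * (of_int (h j) * y m ^ j))"
      by (intro sum.cong refl term_eq) simp
    also have "\<dots> = of_int g ^ s * (\<Sum>j\<le>s. of_int (h j) * y m ^ j)" by (simp only: sum_distrib_left)
    also have "(\<Sum>j\<le>s. of_int (h j) * y m ^ j) = of_int (X m) ^ N * eval_fps (of_int_fps G) (1 / of_int (X m))"
      unfolding G_def eval_form_at_inverse_X[of P N, OF P(1)] h_def ..
    finally have S_xi: "norm (poly (of_int_poly S) \<xi>) = \<bar>real_of_int g\<bar> ^ s * (x ^ N * Z)"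
      using x by (simp add: norm_mult norm_power Z_def x_def)
    have "Z \<noteq> 0" using Z(1) c12(1) by auto
    then have "poly (of_int_poly S) \<xi> \<noteq> 0"
      using S_xi guv(1) x(1) by auto
    moreover have "degree S \<le> s"
      unfolding S_def
    proof (intro degree_sum_le)
      fix j assume "j \<in> {..s}"
      have "degree ([:u, v:] ^ j) \<le> degree [:u, v:] * j" by (rule degree_power_le)
      also have "\<dots> \<le> 1 * j" by (intro mult_right_mono) (auto simp: degree_pCons_le)
      finally show "degree (smult (h j * g ^ (s - j)) ([:u, v:] ^ j)) \<le> s"
        using \<open>j \<in> {..s}\<close> order_trans[OF degree_smult_le] by fastforce
    qed simp
    moreover have "\<bar>coeff S i\<bar> \<le> X m ^ k" for i
    proof -
      have "\<bar>coeff S i\<bar> \<le> (\<Sum>j\<le>s. \<bar>h j\<bar> * (\<bar>g\<bar> ^ (s - j) * \<bar>coeff ([:u, v:] ^ j) i\<bar>))"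
        unfolding S_def coeff_sum coeff_smult
        by (rule order_trans[OF sum_abs]) (simp add: abs_mult power_abs mult.assoc)
      also have "\<dots> \<le> (\<Sum>j\<le>s. (Hj j * X m ^ N) * (X m ^ s * X m ^ (e * s)))"
      proof (rule sum_mono, rule mult_mono)
        fix j assume j: "j \<in> {..s}"
        show "\<bar>h j\<bar> \<le> Hj j * X m ^ N" unfolding h_def using Hj(2) X by simp
        have "\<bar>g\<bar> ^ (s - j) * \<bar>coeff ([:u, v:] ^ j) i\<bar> \<le> (X m ^ e) ^ (s - j) * (X m * X m ^ e) ^ j"
        proof (intro mult_mono power_mono le)
          have "\<bar>coeff ([:u, v:] ^ j) i\<bar> \<le> (2 * X m ^ e) ^ j"
            by (rule coeff_linear_power_bound[OF le(2,3)])
          also have "\<dots> \<le> (X m * X m ^ e) ^ j"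
            using X by (intro power_mono mult_right_mono) auto
          finally show "\<bar>coeff ([:u, v:] ^ j) i\<bar> \<le> (X m * X m ^ e) ^ j" .
        qed (use X in auto)
        also have "\<dots> = X m ^ j * ((X m ^ e) ^ (s - j) * (X m ^ e) ^ j)"
          by (simp add: power_mult_distrib)
        also have "(X m ^ e) ^ (s - j) * (X m ^ e) ^ j = X m ^ (e * s)"
          using j by (simp add: power_mult flip: power_add)
        also have "X m ^ j * X m ^ (e * s) \<le> X m ^ s * X m ^ (e * s)"
          using X j by (intro mult_right_mono power_increasing) auto
        finally show "\<bar>g\<bar> ^ (s - j) * \<bar>coeff ([:u, v:] ^ j) i\<bar> \<le> X m ^ s * X m ^ (e * s)" .
      qed (use X order_trans[OF zero_le_one Hj(1)] in \<open>auto intro!: mult_nonneg_nonneg\<close>)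
      also have "\<dots> = H * (X m ^ N * (X m ^ s * X m ^ (e * s)))"
        by (simp add: H_def sum_distrib_right mult.assoc)
      also have "\<dots> \<le> X m * (X m ^ N * (X m ^ s * X m ^ (e * s)))"
        using X x(2) by (intro mult_right_mono) (auto simp: x_def)
      also have "\<dots> = X m ^ k" by (simp add: k_def power_add)
      finally show ?thesis .
    qed
    moreover have "X m ^ k \<ge> 1" using X by (intro one_le_power) simp
    ultimately have "c \<le> norm (poly (of_int_poly S) \<xi>) * x ^ (k * E)"
      using c(2)[of S "X m ^ k"] by (simp add: x_def power_mult)
    also have "\<dots> = \<bar>real_of_int g\<bar> ^ s * (x ^ N * Z) * x ^ (k * E)" by (simp only: S_xi)
    also have "\<dots> \<le> (x ^ e) ^ s * (x ^ N * Z) * x ^ (k * E)"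
    proof (intro mult_right_mono power_mono)
      have "real_of_int \<bar>g\<bar> \<le> real_of_int (X m ^ e)" using le(1) by (simp only: of_int_le_iff)
      then show "\<bar>real_of_int g\<bar> \<le> x ^ e" by (simp add: x_def)
    qed (use x(1) in \<open>auto simp: Z_def\<close>)
    also have "\<dots> = Z * x ^ (e * s + N + k * E)" by (simp add: power_add power_mult)
    \<comment> \<open>The spare factor \<open>x\<close> will exceed \<open>c2 / c\<close> and so
      outweigh the constants.\<close>
    finally have "c * x \<le> Z * x ^ (e * s + N + k * E) * x" using x(1) by (intro mult_right_mono) auto
    also have "\<dots> = Z * x ^ (e * s + N + k * E + 1)" by simp
    also have "\<dots> \<le> Z * x ^ r"
    proof (intro mult_left_mono power_increasing)
      have "(s + 1) * N = N * E + 2 * N" by (simp add: s_def algebra_simps)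
      moreover have "k * E = E + N * E + s * E + e * s * E" by (simp add: k_def algebra_simps)
      moreover have "N = e * s + 2 * E + s * E + e * s * E + 2" by (simp add: N_def algebra_simps)
      ultimately show "e * s + N + k * E + 1 \<le> r" using r_ge by linarith
    qed (use x(1) in \<open>auto simp: Z_def\<close>)
    also have "\<dots> \<le> c2" by (rule Z(2))
    finally have "c * x \<le> c2" .
    moreover have "c2 < c * x" using x(3) c(1) by (simp add: field_simps)
    ultimately show False by linarith
  qed
  then show False by simp
qed

end

section \<open>The irrationality exponent\<close>

text \<open>Finitely many rationals keep a positive distance from the irrational \<open>x\<close>,
  but Dirichlet's theorem supplies a closer one that again belongs to the set.\<close>

lemma infinite_quadratic_approximations:
  fixes x :: real
  assumes "x \<notin> \<rat>"
  shows "infinite {r :: rat. case quotient_of r of (p, q) \<Rightarrow>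
    \<bar>x - real_of_int p / real_of_int q\<bar> < real_of_int q powr - 2}"
proof
  define S where "S = {r :: rat. case quotient_of r of (p, q) \<Rightarrow>
    \<bar>x - real_of_int p / real_of_int q\<bar> < real_of_int q powr - 2}"
  assume "finite {r :: rat. case quotient_of r of (p, q) \<Rightarrow>
    \<bar>x - real_of_int p / real_of_int q\<bar> < real_of_int q powr - 2}"
  then have fin: "finite S" by (simp add: S_def)
  \<comment> \<open>Inserting 1 makes the minimum meaningful when \<open>S\<close> is empty.\<close>
  define \<delta> where "\<delta> = Min (insert 1 ((\<lambda>r. \<bar>x - of_rat r\<bar>) ` S))"
  have "x \<noteq> of_rat r" for r using assms by auto
  then have "\<delta> > 0" using fin by (simp add: \<delta>_def Min_gr_iff)
  then obtain n where n: "inverse (real (Suc n)) < \<delta>" by (metis reals_Archimedean)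
  obtain h k where hk: "coprime h k" "0 < k" "k \<le> int (Suc n)" "\<bar>of_int k * x - of_int h\<bar> < 1 / real (Suc n)"
    by (rule Dirichlet_approx_coprime[of "Suc n" x]) auto
  define r where "r = Fract h k"
  have r: "quotient_of r = (h, k)"
    using hk by (simp add: r_def quotient_of_Fract normalize_stable)
  have dist: "\<bar>x - of_int h / of_int k\<bar> = \<bar>of_int k * x - of_int h\<bar> / of_int k"
  proof -
    have "x - of_int h / of_int k = (of_int k * x - of_int h) / of_int k" using hk(2) by (simp add: field_simps)
    then show ?thesis using hk(2) by simp
  qed
  have k: "real_of_int k \<le> real (Suc n)" "real_of_int k \<ge> 1" using hk by linarith+
  have "\<bar>of_int k * x - of_int h\<bar> / of_int k < 1 / real (Suc n) / of_int k"
    using hk k by (intro divide_strict_right_mono) auto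
  also have "\<dots> \<le> 1 / of_int k / of_int k"
    using k by (intro divide_right_mono divide_left_mono) auto
  also have "\<dots> = real_of_int k powr - 2"
    using hk(2) by (simp add: powr_minus power2_eq_square field_simps)
  finally have "r \<in> S" by (simp add: S_def r dist)
  then have "\<delta> \<le> \<bar>x - of_rat r\<bar>" unfolding \<delta>_def using fin by (intro Min_le) auto
  also have "\<dots> = \<bar>x - of_int h / of_int k\<bar>" using hk(2) by (simp add: r_def of_rat_rat)
  also have "\<dots> \<le> \<bar>of_int k * x - of_int h\<bar> / 1"
    unfolding dist using k by (intro divide_left_mono) auto
  also have "\<dots> < \<delta>" using hk(4) n by (simp add: inverse_eq_divide)
  finally show False by simp
qed

text \<open>Because \<open>\<mu> \<ge> 0\<close>, an approximation in the set has error below 1, so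
  a bounded denominator forces a bounded numerator. Only large denominators require a distance
  estimate.\<close>

lemma finite_approximationsI:
  fixes x \<mu> :: real and Q :: int
  assumes "\<mu> \<ge> 0"
    and bound: "\<And>p q. q \<ge> Q \<Longrightarrow> q > 0 \<Longrightarrow> of_int q powr - \<mu> \<le> \<bar>x - real_of_int p / real_of_int q\<bar>"
  shows "finite {r :: rat. case quotient_of r of (p, q) \<Rightarrow>
    \<bar>x - real_of_int p / real_of_int q\<bar> < real_of_int q powr - \<mu>}"
proof (rule finite_subset)
  define M where "M = \<lceil>real_of_int Q * (\<bar>x\<bar> + 1)\<rceil>"
  show "{r :: rat. case quotient_of r of (p, q) \<Rightarrow>
    \<bar>x - real_of_int p / real_of_int q\<bar> < real_of_int q powr - \<mu>} \<subseteq> (\<lambda>(p, q). Fract p q) ` ({- M..M} \<times> {0<..Q})"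
  proof safe
    fix r :: rat and p q
    assume r: "quotient_of r = (p, q)" and lt: "\<bar>x - real_of_int p / real_of_int q\<bar> < real_of_int q powr - \<mu>"
    have q: "q > 0" using r by (rule quotient_of_denom_pos)
    with lt bound[of q p] have "q \<le> Q" by linarith
    have "real_of_int q powr - \<mu> \<le> real_of_int q powr 0" using q assms(1) by (intro powr_mono) auto
    with lt have "\<bar>x - real_of_int p / real_of_int q\<bar> < 1" using q by simp
    then have "\<bar>real_of_int p / real_of_int q\<bar> \<le> \<bar>x\<bar> + 1" by linarith
    then have "\<bar>real_of_int p\<bar> \<le> real_of_int q * (\<bar>x\<bar> + 1)" using q by (simp add: field_simps abs_divide)
    also have "\<dots> \<le> real_of_int Q * (\<bar>x\<bar> + 1)" using \<open>q \<le> Q\<close> by (intro mult_right_mono) auto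
    finally have "\<bar>p\<bar> \<le> M" unfolding M_def by linarith
    then have "(p, q) \<in> {- M..M} \<times> {0<..Q}" using q \<open>q \<le> Q\<close> by auto
    moreover have "r = Fract p q"
      using r q by (metis Fract_of_int_quotient quotient_of_div)
    ultimately show "r \<in> (\<lambda>(p, q). Fract p q) ` ({- M..M} \<times> {0<..Q})" by (intro image_eqI[of _ _ "(p, q)"]) auto
  qed
qed auto

text \<open>When \<open>p / q = p' / q'\<close> the approximation \<open>p' / q'\<close> bounds the distance to \<open>x\<close> directly;
  this is why a lower bound on \<open>\<bar>q' x - p'\<bar>\<close> is needed, and no linear independence of
  consecutive approximations.\<close>

lemma distance_lower_bound:
  fixes x Y :: real and p q p' q' :: int
  assumes "q > 0" and "\<bar>of_int q'\<bar> \<le> Y"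
    and lower: "1 \<le> \<bar>of_int q' * x - of_int p'\<bar> * Y"
    and upper: "\<bar>of_int q' * x - of_int p'\<bar> * (2 * of_int q) \<le> 1"
    and "2 * of_int q \<le> Y"
  shows "1 / Y\<^sup>2 \<le> \<bar>x - of_int p / of_int q\<bar>"
proof -
  define L where "L = \<bar>of_int q' * x - of_int p'\<bar>"
  have q: "real_of_int q \<ge> 1" using \<open>q > 0\<close> by linarith
  have Y: "Y > 0" using q assms(5) by linarith
  have L: "L > 0" using lower Y by (cases "L = 0") (auto simp: L_def)
  show ?thesis
  proof (cases "p * q' = q * p'")
    case True
    then have eq: "real_of_int p * of_int q' = of_int q * of_int p'" by (metis of_int_mult)
    have "q' \<noteq> 0"
    proof
      assume "q' = 0"
      with True \<open>q > 0\<close> have "p' = 0" by simp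
      with \<open>q' = 0\<close> L show False by (simp add: L_def)
    qed
    have "1 / Y\<^sup>2 = 1 / Y / Y" by (simp add: power2_eq_square)
    also have "\<dots> \<le> L / \<bar>of_int q'\<bar>"
      using lower Y assms(2) \<open>q' \<noteq> 0\<close> by (intro frac_le) (auto simp: L_def field_simps)
    also have "\<dots> = \<bar>(of_int q' * x - of_int p') / of_int q'\<bar>" by (simp add: L_def)
    also have "(of_int q' * x - of_int p') / of_int q' = x - of_int p / of_int q"
      using eq \<open>q' \<noteq> 0\<close> q by (simp add: field_simps)
    finally show ?thesis .
  next
    case False
    \<comment> \<open>The determinant is a nonzero integer; the upper bound on \<open>L\<close>
      leaves at least 1/2 to the term containing \<open>q x - p\<close>.\<close>
    then have "1 \<le> \<bar>p * q' - q * p'\<bar>" by linarith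
    then have "1 \<le> \<bar>real_of_int (p * q' - q * p')\<bar>" by linarith
    also have "real_of_int (p * q' - q * p') = of_int q * (of_int q' * x - of_int p') - of_int q' * (of_int q * x - of_int p)"
      by (simp add: algebra_simps)
    also have "\<bar>\<dots>\<bar> \<le> of_int q * L + \<bar>of_int q'\<bar> * \<bar>of_int q * x - of_int p\<bar>"
      using q by (intro order_trans[OF abs_triangle_ineq4]) (simp add: abs_mult L_def)
    also have "\<dots> \<le> 1 / 2 + Y * \<bar>of_int q * x - of_int p\<bar>"
    proof (intro add_mono mult_right_mono assms(2))
      have "2 * (of_int q * L) \<le> 1" using upper by (simp only: L_def mult_ac)
      then show "of_int q * L \<le> 1 / 2" by simp
    qed simp
    finally have "1 / (2 * Y) \<le> \<bar>of_int q * x - of_int p\<bar>" using Y by (simp add: field_simps)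
    then have "1 / (2 * Y) / of_int q \<le> \<bar>of_int q * x - of_int p\<bar> / of_int q"
      using q by (intro divide_right_mono) auto
    also have "\<dots> = \<bar>(of_int q * x - of_int p) / of_int q\<bar>" using q by simp
    also have "(of_int q * x - of_int p) / of_int q = x - of_int p / of_int q" using q by (simp add: field_simps)
    finally have "1 / (2 * Y) / of_int q \<le> \<bar>x - of_int p / of_int q\<bar>" .
    moreover have "1 / Y\<^sup>2 \<le> 1 / (2 * Y) / of_int q"
      using Y q assms(5) by (simp add: power2_eq_square frac_le)
    ultimately show ?thesis by linarith
  qed
qed

context mahler_number
begin

text \<open>Given \<open>q\<close>, first \<open>m\<close> is fixed by
  \<open>X_m^K \<le> 2 q < X_m^(2 K)\<close>, then \<open>N\<close> as the least exponent with
  \<open>2 q \<le> X_m^N\<close>. Rounding up to \<open>N\<close> loses at most one factor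
  \<open>X_m\<close>, and the total loss \<open>X_m^(2 e + 1)\<close> is at most
  \<open>(2 q)^\<delta>\<close>.\<close>

lemma finite_good_approximations:
  fixes x \<mu> :: real
  assumes x: "\<xi> = of_real x" and \<mu>: "\<mu> > 2"
  shows "finite {r :: rat. case quotient_of r of (p, q) \<Rightarrow>
    \<bar>x - real_of_int p / real_of_int q\<bar> < real_of_int q powr - \<mu>}"
proof -
  obtain e where e: "\<And>N. eventually (\<lambda>m. \<exists>p q :: int. \<bar>q\<bar> \<le> X m ^ (N + e) \<and>
    1 \<le> norm (of_int q * \<xi> - of_int p) * real_of_int (X m) ^ (N + e) \<and>
    norm (of_int q * \<xi> - of_int p) * real_of_int (X m) ^ N \<le> real_of_int (X m) ^ e) sequentially"
    using good_approximations by blast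
  \<comment> \<open>\<open>K\<close> is large enough for \<open>2 * \<delta> < \<mu> - 2\<close>,
    where \<open>\<delta>\<close> is such that \<open>X^(2 e + 1) = (X^K)^\<delta>\<close>.\<close>
  define K where "K = nat \<lceil>(4 * real e + 2) / (\<mu> - 2)\<rceil> + 1"
  define \<delta> where "\<delta> = (2 * real e + 1) / real K"
  have K: "K > 0" by (simp add: K_def)
  have "(4 * real e + 2) / (\<mu> - 2) < real K" unfolding K_def by linarith
  then have "2 + 2 * \<delta> < \<mu>" using \<mu> K by (simp add: \<delta>_def field_simps)
  have "\<delta> \<ge> 0" by (simp add: \<delta>_def)
  have norm_eq: "norm (of_int q * \<xi> - of_int p) = \<bar>of_int q * x - of_int p\<bar>" for p q
  proof -
    have "of_int q * \<xi> - of_int p = of_real (of_int q * x - of_int p)" by (simp add: x)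
    then show ?thesis by (metis norm_of_real)
  qed
  \<comment> \<open>Only finitely many \<open>N\<close> will occur, so one threshold
    \<open>m0\<close> serves them all.\<close>
  have "eventually (\<lambda>m. \<forall>N\<in>{..2 * K + e}. \<exists>p q :: int. \<bar>q\<bar> \<le> X m ^ (N + e) \<and>
    1 \<le> norm (of_int q * \<xi> - of_int p) * real_of_int (X m) ^ (N + e) \<and>
    norm (of_int q * \<xi> - of_int p) * real_of_int (X m) ^ N \<le> real_of_int (X m) ^ e) sequentially"
    using e by (intro eventually_ball_finite) auto
  then obtain m0 where m0: "\<And>m N. m \<ge> m0 \<Longrightarrow> N \<le> 2 * K + e \<Longrightarrow> \<exists>p q :: int. \<bar>q\<bar> \<le> X m ^ (N + e) \<and>
    1 \<le> \<bar>of_int q * x - of_int p\<bar> * real_of_int (X m) ^ (N + e) \<and>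
    \<bar>of_int q * x - of_int p\<bar> * real_of_int (X m) ^ N \<le> real_of_int (X m) ^ e"
    unfolding eventually_sequentially norm_eq by (metis atMost_iff)
  have lower: "(2 * real_of_int q) powr - (2 + 2 * \<delta>) \<le> \<bar>x - of_int p / of_int q\<bar>"
    if q: "q > 0" "q \<ge> X m0 ^ K" for p q :: int
  proof -
    define T where "T = 2 * real_of_int q"
    have T: "T \<ge> 2" using q by (simp add: T_def)
    have T0: "real_of_int (X m0) ^ K \<le> T"
    proof -
      have "real_of_int (X m0 ^ K) \<le> real_of_int q" using q(2) by (simp only: of_int_le_iff)
      moreover have "0 < real_of_int q" using q(1) by simp
      ultimately show ?thesis unfolding T_def of_int_power[symmetric] by linarith
    qed
    have "\<exists>n. T < real_of_int (X (m0 + n)) ^ K"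
    proof -
      obtain n where "\<And>m. m \<ge> n \<Longrightarrow> T + 1 \<le> real_of_int (X m)"
        using eventually_le_X[of "T + 1"] by (auto simp: eventually_sequentially)
      then have "T < real_of_int (X (m0 + n))" by (smt (verit) le_add2)
      also have "\<dots> \<le> real_of_int (X (m0 + n)) ^ K"
        using X_ge_2[of "m0 + n"] K by (intro self_le_power) auto
      finally show ?thesis by blast
    qed
    then obtain n where n: "T < real_of_int (X (m0 + n)) ^ K" "\<And>n'. n' < n \<Longrightarrow> \<not> T < real_of_int (X (m0 + n')) ^ K"
      using exists_least_iff[of "\<lambda>n. T < real_of_int (X (m0 + n)) ^ K"] by blast
    have "n \<noteq> 0" using n(1) T0 by (cases "n = 0") auto
    \<comment> \<open>\<open>m\<close> is the last index before \<open>X^K\<close> exceeds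
      \<open>T\<close>. Passing to \<open>Suc m\<close> squares \<open>X m\<close>, hence the window
      from \<open>K\<close> to \<open>2 K\<close>.\<close>
    define m where "m = m0 + (n - 1)"
    define X' where "X' = real_of_int (X m)"
    have X': "X' \<ge> 2" using X_ge_2[of m] by (simp add: X'_def)
    have "m0 + n = Suc m" using \<open>n \<noteq> 0\<close> by (simp add: m_def)
    then have T_less: "T < X' ^ (2 * K)" using n(1) by (simp add: X'_def X_Suc power_mult)
    have T_ge: "X' ^ K \<le> T" using n(2)[of "n - 1"] \<open>n \<noteq> 0\<close> by (simp add: X'_def m_def not_less)
    obtain N where N: "T \<le> X' ^ N" "\<And>N'. N' < N \<Longrightarrow> \<not> T \<le> X' ^ N'"
      using exists_least_iff[of "\<lambda>N. T \<le> X' ^ N"] T_less less_imp_le by blast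
    have "N \<le> 2 * K" using N(2)[of "2 * K"] T_less by (meson less_imp_le not_le)
    have "N \<noteq> 0" using N(1) T by (cases "N = 0") auto
    \<comment> \<open>The form is taken with index \<open>N + e\<close> instead of \<open>N\<close>,
      so that its upper bound becomes \<open>X'^(- N)\<close>, which is at most
      \<open>1 / T\<close>.\<close>
    obtain p' q' :: int where q': "\<bar>q'\<bar> \<le> X m ^ (N + e + e)"
      "1 \<le> \<bar>of_int q' * x - of_int p'\<bar> * X' ^ (N + e + e)"
      "\<bar>of_int q' * x - of_int p'\<bar> * X' ^ (N + e) \<le> X' ^ e"
      using m0[of m "N + e"] \<open>N \<le> 2 * K\<close> unfolding X'_def m_def by auto
    define Y where "Y = X' ^ (N + e + e)"
    have "1 / Y\<^sup>2 \<le> \<bar>x - of_int p / of_int q\<bar>"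
    proof (rule distance_lower_bound[OF q(1), of q' Y x p' p])
      have "real_of_int \<bar>q'\<bar> \<le> real_of_int (X m ^ (N + e + e))" using q'(1) by (simp only: of_int_le_iff)
      then show "\<bar>real_of_int q'\<bar> \<le> Y" by (simp add: Y_def X'_def)
      show "1 \<le> \<bar>of_int q' * x - of_int p'\<bar> * Y" using q'(2) by (simp add: Y_def)
      have "\<bar>of_int q' * x - of_int p'\<bar> * X' ^ N * X' ^ e \<le> 1 * X' ^ e" using q'(3) by (simp add: power_add)
      then have "\<bar>of_int q' * x - of_int p'\<bar> * X' ^ N \<le> 1" using X' by simp
      moreover have "\<bar>of_int q' * x - of_int p'\<bar> * T \<le> \<bar>of_int q' * x - of_int p'\<bar> * X' ^ N"
        using N(1) by (intro mult_left_mono) auto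
      ultimately show "\<bar>of_int q' * x - of_int p'\<bar> * (2 * of_int q) \<le> 1" by (simp add: T_def)
      have "X' ^ N \<le> Y" unfolding Y_def using X' by (intro power_increasing) auto
      with N(1) show "2 * of_int q \<le> Y" by (simp add: T_def)
    qed
    moreover have "T powr - (2 + 2 * \<delta>) \<le> 1 / Y\<^sup>2"
    proof -
      have "X' ^ (2 * e + 1) = X' powr (real K * \<delta>)"
        using X' K by (subst powr_realpow[symmetric]) (auto simp: \<delta>_def add.commute)
      also have "\<dots> = (X' ^ K) powr \<delta>" using X' by (simp add: powr_powr flip: powr_realpow)
      also have "\<dots> \<le> T powr \<delta>" using T_ge X' \<open>\<delta> \<ge> 0\<close> by (intro powr_mono2) auto
      finally have "X' ^ (2 * e + 1) \<le> T powr \<delta>" .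
      moreover have "X' ^ (N - 1) \<le> T" using N(2)[of "N - 1"] \<open>N \<noteq> 0\<close> by simp
      ultimately have "X' ^ (N - 1) * X' ^ (2 * e + 1) \<le> T * T powr \<delta>"
        using X' T by (intro mult_mono) auto
      also have "X' ^ (N - 1) * X' ^ (2 * e + 1) = Y"
        unfolding Y_def power_add[symmetric] using \<open>N \<noteq> 0\<close> by (intro arg_cong[of _ _ "power X'"]) auto
      also have "T * T powr \<delta> = T powr (1 + \<delta>)" using T by (simp add: powr_add)
      finally have "Y\<^sup>2 \<le> (T powr (1 + \<delta>))\<^sup>2" using X' by (intro power_mono) (auto simp: Y_def)
      also have "\<dots> = T powr (2 + 2 * \<delta>)" using T by (simp add: power2_eq_square flip: powr_add)
      finally show ?thesis using X' T unfolding powr_minus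
        by (simp add: inverse_eq_divide frac_le Y_def)
    qed
    ultimately show ?thesis by (simp add: T_def)
  qed
  define \<eta> where "\<eta> = \<mu> - (2 + 2 * \<delta>)"
  have "\<eta> > 0" using \<open>2 + 2 * \<delta> < \<mu>\<close> by (simp add: \<eta>_def)
  \<comment> \<open>Beyond \<open>Q\<close> the constant \<open>2 powr (2 + 2 * \<delta>)\<close> is
    absorbed by \<open>q powr \<eta>\<close>, where \<open>\<eta>\<close> is the room left below
    \<open>\<mu>\<close>.\<close>
  define Q where "Q = max (X m0 ^ K) \<lceil>(2 powr (2 + 2 * \<delta>)) powr (1 / \<eta>)\<rceil>"
  show ?thesis
  proof (rule finite_approximationsI[of _ Q])
    fix p q :: int assume q: "q \<ge> Q" "q > 0"
    have "2 powr (2 + 2 * \<delta>) = ((2 powr (2 + 2 * \<delta>)) powr (1 / \<eta>)) powr \<eta>"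
      using \<open>\<eta> > 0\<close> by (simp add: powr_powr)
    also have "\<dots> \<le> of_int q powr \<eta>"
    proof (intro powr_mono2)
      have "\<lceil>(2 powr (2 + 2 * \<delta>)) powr (1 / \<eta>)\<rceil> \<le> q" using q by (simp add: Q_def)
      then show "(2 powr (2 + 2 * \<delta>)) powr (1 / \<eta>) \<le> of_int q" by (simp add: ceiling_le_iff)
    qed (use \<open>\<eta> > 0\<close> in auto)
    finally have "2 powr (2 + 2 * \<delta>) * of_int q powr (2 + 2 * \<delta>) \<le> of_int q powr \<eta> * of_int q powr (2 + 2 * \<delta>)"
      by (intro mult_right_mono) auto
    then have "(2 * real_of_int q) powr (2 + 2 * \<delta>) \<le> of_int q powr \<mu>"
      using q(2) by (simp add: powr_mult \<eta>_def flip: powr_add)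
    then have "of_int q powr - \<mu> \<le> (2 * real_of_int q) powr - (2 + 2 * \<delta>)"
      using q(2) unfolding powr_minus by (intro le_imp_inverse_le) auto
    also have "\<dots> \<le> \<bar>x - of_int p / of_int q\<bar>" using q by (intro lower) (auto simp: Q_def)
    finally show "of_int q powr - \<mu> \<le> \<bar>x - of_int p / of_int q\<bar>" .
  qed (use \<mu> in simp)
qed

end

section \<open>Transfer from the complex setting to the real value \<open>f(1/b)\<close>\<close>

theorem theorem6p1:
  fixes f :: "nat \<Rightarrow> int" and A B C :: "int poly" and b :: int
  assumes analytic: "\<And>z::complex. norm z < 1 \<Longrightarrow> summable (\<lambda>n. of_int (f n) * z ^ n)"
    and funeq: "\<And>z::complex. norm z < 1 \<Longrightarrow>
        poly (map_poly of_int A) z + poly (map_poly of_int B) z * (\<Sum>n. of_int (f n) * z ^ n)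
        + poly (map_poly of_int C) z * (\<Sum>n. of_int (f n) * (z\<^sup>2) ^ n) = 0"
    and cond: "(coeff B 0 mod 2 = 1 \<and> coeff C 0 mod 2 = 0) \<or>
               (coeff A 0 mod 2 = 0 \<and> coeff B 0 mod 2 = 1 \<and> coeff C 0 mod 2 \<noteq> 0)"
    and b: "b \<ge> 2"
    and nonvan: "\<And>m::nat. poly (map_poly real_of_int B) (1 / real_of_int b ^ (2 ^ m)) *
                         poly (map_poly real_of_int C) (1 / real_of_int b ^ (2 ^ m)) \<noteq> 0"
    and nonrat: "\<not> rational_fps_F2 (fps_mod2 f)"
  shows "\<not> algebraic (\<Sum>n. real_of_int (f n) * (1 / real_of_int b) ^ n)
     \<and> irrationality_exponent (\<Sum>n. real_of_int (f n) * (1 / real_of_int b) ^ n) = 2"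
proof -
  define F where "F = Abs_fps f"
  have eval_F: "eval_fps (of_int_fps F) z = (\<Sum>n. of_int (f n) * z ^ n)" for z :: complex
    by (simp add: eval_fps_def F_def)
  have poly_of_real: "poly (of_int_poly p) (complex_of_real x) = of_real (poly (of_int_poly p) x)" for p x
    by (simp add: poly_of_int_poly_eq_sum[OF order_refl])
  interpret mahler_number F A B C b
  proof
    show "fps_conv_radius (of_int_fps F :: complex fps) \<ge> 1"
      unfolding fps_conv_radius_def by (rule conv_radius_geI_ex') (use analytic in \<open>simp add: F_def\<close>)
    show "poly (of_int_poly A) z + poly (of_int_poly B) z * eval_fps (of_int_fps F) z +
        poly (of_int_poly C) z * eval_fps (of_int_fps F) (z\<^sup>2) = 0" if "norm z < 1" for z :: complex
      using funeq[OF that] by (simp add: eval_F)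
    show "of_int_poly B \<noteq> (0 :: bit poly)"
    proof -
      have "odd (coeff B 0)" using cond by (auto simp: odd_iff_mod_2_eq_one)
      then have "coeff (of_int_poly B :: bit poly) 0 \<noteq> 0" by (simp add: coeff_map_poly of_int_bit)
      then show ?thesis by auto
    qed
    show "poly (of_int_poly C) (1 / of_int (b ^ 2 ^ m) :: complex) \<noteq> 0" for m
      using nonvan[of m] poly_of_real[of C "1 / real_of_int b ^ 2 ^ m"] by auto
    show "fps_of_poly Q * of_int_fps F \<noteq> fps_of_poly P" if "Q \<noteq> 0" for P Q :: "bit poly"
      using nonrat that by (auto simp: rational_fps_F2_def F_def of_int_fps_bit)
  qed (fact b)
  define x where "x = (\<Sum>n. real_of_int (f n) * (1 / real_of_int b) ^ n)"
  \<comment> \<open>Summability lets the embedding of the reals commute with the infinite sum, which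
    identifies \<open>\<xi>\<close> with \<open>x\<close>.\<close>
  have "norm (1 / of_int b :: complex) < 1" using b by (simp add: norm_divide)
  then have "summable (\<lambda>n. complex_of_real (real_of_int (f n) * (1 / real_of_int b) ^ n))"
    using analytic by simp
  then have "summable (\<lambda>n. real_of_int (f n) * (1 / real_of_int b) ^ n)"
    by (simp only: summable_of_real_iff)
  then have x: "\<xi> = of_real x"
    by (simp add: y_def X_def eval_F x_def suminf_of_real)
  \<comment> \<open>An integer polynomial relation for the real \<open>x\<close> is also one for the
    complex \<open>\<xi>\<close>.\<close>
  have alg: "\<not> algebraic x"
  proof
    assume "algebraic x"
    then obtain p where p: "p \<noteq> 0" "poly (of_int_poly p) x = 0" by (rule algebraic_int_poly)
    then have "poly (of_int_poly p) \<xi> = 0" by (simp add: x poly_of_real)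
    moreover have "of_int_poly p \<noteq> (0 :: complex poly)"
      using p(1) by (auto simp: poly_eq_iff coeff_map_poly)
    ultimately have "algebraic \<xi>" by (intro algebraicI) (auto simp: coeff_map_poly)
    with transcendental show False by blast
  qed
  moreover have "irrationality_exponent x = 2"
    unfolding irrationality_exponent_def
  \<comment> \<open>Exponents above 2 admit only finitely many approximations, while 2 itself
    belongs to the set by Dirichlet's theorem.\<close>
  proof (intro antisym Sup_least)
    fix t assume "t \<in> ereal ` {mu. infinite {r. case quotient_of r of (p, q) \<Rightarrow>
      \<bar>x - real_of_int p / real_of_int q\<bar> < real_of_int q powr - mu}}"
    then obtain mu where mu: "t = ereal mu" "infinite {r. case quotient_of r of (p, q) \<Rightarrow>
      \<bar>x - real_of_int p / real_of_int q\<bar> < real_of_int q powr - mu}" by blast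
    then have "mu \<le> 2" using finite_good_approximations[OF x, of mu] by (meson not_le)
    then show "t \<le> 2" by (simp add: mu(1))
  next
    have "x \<notin> \<rat>" using alg rat_imp_algebraic by blast
    then show "2 \<le> Sup (ereal ` {mu. infinite {r. case quotient_of r of (p, q) \<Rightarrow>
      \<bar>x - real_of_int p / real_of_int q\<bar> < real_of_int q powr - mu}})"
      by (intro Sup_upper image_eqI[of _ _ 2]) (simp_all add: infinite_quadratic_approximations)
  qed
  ultimately show ?thesis by (simp add: x_def)
qed

end
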